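(* Let $J=\|\cdot\|_1$ on $\mathbb{R}^p$ and assume the following. (1) There is a convex non-decreasing function $\varphi:\mathbb{R}_+\to\mathbb{R}_+$ vanishing only at $0$ such that, for all $y\in\mathbb{R}^n$, $F(\cdot,y)$ is $C^1(\mathbb{R}^n)$ and $F(v,y)\ge F(u,y)+\langle\nabla F(u,y),v-u\rangle+\varphi(\|v-u\|_2)$ for all $u,v\in\mathbb{R}^n$. (2) For any $\bar x\in\mathbb{R}^p$ and $y\in\mathbb{R}^n$, $\int_{\mathbb{R}^p}\exp(-F(Xx,y)/(n\beta))\,|\langle\nabla F(Xx,y),X(\bar x-x)\rangle|\,dx<+\infty$. (3) $y_1,\dots,y_n$ are independent and identically distributed, $F(u,y)=\sum_{i=1}^nf_i(u_i,y_i)$ with $f_i:\mathbb{R}\times\mathbb{R}\to\mathbb{R}$, and for all $1\le i\le n$: (i) $\mathbb{E}|f_i((Xx_0)_i,y_i)|<+\infty$; (ii) $|f_i'((Xx_0)_i,t)|\le g(t)$ where $\mathbb{E}\,g(y_i)<+\infty$; (iii) for all integers $m\ge2$, $\mathbb{E}|f_i'((Xx_0)_i,y_i)|^m\le m!\,\kappa^{m-2}\sigma_i^2/2$ for some constants $\kappa>0,\sigma_i>0$ independent of $n$. Let $\sigma^2=\max_{1\le i\le n}\sigma_i^2$. Suppose that $\operatorname{rank}(X)=n$ and $\max_i\|X_i\|_\infty\le1$, where $X_i$ is the $i$-th column of $X$, and take $$\lambda_n\ge\tau\sigma\sqrt{\frac{2\delta\log(2p)}{n}}\left(1+\sqrt2\,\frac{\kappa}{\sigma}\sqrt{\frac{\delta\log(2p)}{n}}\right)$$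 for some $\tau>1$ and $\delta>1$. Let $V_n(x)=\frac1nF(Xx,y)+\lambda_n\|x\|_1$, let $\widehat{x}^{\mathrm{EWA}}_n=\int_{\mathbb{R}^p}x\,\mu_n(x)\,dx$ with $\mu_n$ the probability density proportional to $\exp(-V_n/\beta)$ on $\mathbb{R}^p$, and let $\widehat{x}^{\mathrm{PEN}}_n$ be a minimizer of $V_n$ over $\mathbb{R}^p$. Then, with probability at least $1-2(2p)^{1-\delta}$, both $$R_n(\widehat{x}^{\mathrm{EWA}}_n,x_0)\le\inf_{\substack{I\subset\{1,\dots,p\} \\ x:\ \operatorname{supp}(x)=I}}\left(R_n(x,x_0)+\frac1n\varphi^+\!\left(\frac{\lambda_n\sqrt n(\tau+1)\sqrt{|I|}}{\tau\,\Upsilon\!\left(\operatorname{Span}\{a_i\}_{i\in I},\frac{\tau+1}{\tau-1}\right)}\right)\right)+p\beta$$ and $$R_n(\widehat{x}^{\mathrm{PEN}}_n,x_0)\le\inf_{\substack{I\subset\{1,\dots,p\} \\ x:\ \operatorname{supp}(x)=I}}\left(R_n(x,x_0)+\frac1n\varphi^+\!\left(\frac{\lambda_n\sqrt n(\tau+1)\sqrt{|I|}}{\tau\,\Upsilon\!\left(\operatorname{Span}\{a_i\}_{i\in I},\frac{\tau+1}{\tau-1}\right)}\right)\right).$$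
   Context: $y=(y_1,\dots,y_n)\in\mathbb{R}^n$ is the random vector of observations, $X\in\mathbb{R}^{n\times p}$ is deterministic, $F:\mathbb{R}^n\times\mathbb{R}^n\to\mathbb{R}$ is the loss, $\lambda_n>0$, $\beta>0$, and $x_0$ is any element of $\operatorname{Argmin}_{x\in\mathbb{R}^p}\mathbb{E}[F(Xx,y)]$. $\nabla F(u,y)$ is the gradient of $F$, and $f_i'$ the derivative of $f_i$, with respect to the first variable. $(a_i)_{1\le i\le p}$ is the canonical basis of $\mathbb{R}^p$ and $\operatorname{supp}(x)=\{i:x_i\ne0\}$. Loss: $R_n(x,x_0)=\frac1n\big(F(Xx,y)-F(Xx_0,y)-\langle\nabla F(Xx_0,y),Xx-Xx_0\rangle\big)$. Monotone conjugate: $\varphi^+(a)=\sup_{t\ge0}(at-\varphi(t))$, $a\ge0$. For a subspace $T\subset\mathbb{R}^p$ with $S=T^\perp$, $P_T$ is the orthogonal projector on $T$, $\omega_T=P_T\omega$, $|||P_T|||_{2\to1}=\sup_{\|\omega\|_2\le1}\|P_T\omega\|_1$, and for $c>0$ $$\Upsilon(T,c)=\inf_{\omega\in\mathbb{R}^p:\ \|\omega_S\|_1<c\|\omega_T\|_1}\frac{|||P_T|||_{2\to1}\,\|X\omega\|_2}{n^{1/2}\,(\|\omega_T\|_1-\|\omega_S\|_1/c)} .$$ Conventions: $\inf\emptyset=+\infty$, $a/(+\infty)=0$, $a/0=+\infty$ for $a>0$, and $\varphi^+(+\infty)=+\infty$.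
   Formalization: The risk E[F(Xx,y)] is additionally assumed to be finite (F(Xx,y) integrable) for every x, and F(u,·) to be Borel measurable; if the risk may be infinite away from x_0, the claim can fail. *)

theory Defs
  imports "HOL-Probability.Probability"
begin

definition l1_norm :: "real ^ 'p \<Rightarrow> real" where
  "l1_norm x = (\<Sum>i\<in>UNIV. \<bar>x $ i\<bar>)"

definition supp :: "real ^ 'p \<Rightarrow> 'p set" where
  "supp x = {i. x $ i \<noteq> 0}"

definition gradient :: "('a::real_inner \<Rightarrow> real) \<Rightarrow> 'a \<Rightarrow> 'a" where
  "gradient f x = (THE D. GDERIV f x :> D)"

definition C1_fun :: "('a::real_inner \<Rightarrow> real) \<Rightarrow> bool" where
  "C1_fun f \<longleftrightarrow> (\<forall>x. GDERIV f x :> gradient f x) \<and> continuous_on UNIV (gradient f)"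

text \<open>
  In all that follows the loss \<open>F u y\<close> takes the prediction \<open>u\<close> first and the observation \<open>y\<close>
  second, and \<open>n\<close>, \<open>p\<close> are the cardinalities of the index types \<open>'n\<close>, \<open>'p\<close>.
\<close>

definition excess_loss ::
  "(real ^ 'n \<Rightarrow> real ^ 'n \<Rightarrow> real) \<Rightarrow> real ^ 'p ^ 'n \<Rightarrow> real ^ 'n \<Rightarrow> real ^ 'p \<Rightarrow> real ^ 'p \<Rightarrow> real" where
  "excess_loss F X y x x0 =
     (1 / real CARD('n)) *
       (F (X *v x) y - F (X *v x0) y - gradient (\<lambda>u. F u y) (X *v x0) \<bullet> (X *v x - X *v x0))"

definition penalized ::
  "(real ^ 'n \<Rightarrow> real ^ 'n \<Rightarrow> real) \<Rightarrow> real ^ 'p ^ 'n \<Rightarrow> real \<Rightarrow> real ^ 'n \<Rightarrow> real ^ 'p \<Rightarrow> real" where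
  "penalized F X lam y x = (1 / real CARD('n)) * F (X *v x) y + lam * l1_norm x"

definition ewa_density ::
  "(real ^ 'n \<Rightarrow> real ^ 'n \<Rightarrow> real) \<Rightarrow> real ^ 'p ^ 'n \<Rightarrow> real \<Rightarrow> real \<Rightarrow> real ^ 'n \<Rightarrow> real ^ 'p \<Rightarrow> real" where
  "ewa_density F X lam \<beta> y x =
     exp (- penalized F X lam y x / \<beta>) / (\<integral>z. exp (- penalized F X lam y z / \<beta>) \<partial>lborel)"

definition ewa ::
  "(real ^ 'n \<Rightarrow> real ^ 'n \<Rightarrow> real) \<Rightarrow> real ^ 'p ^ 'n \<Rightarrow> real \<Rightarrow> real \<Rightarrow> real ^ 'n \<Rightarrow> real ^ 'p" where
  "ewa F X lam \<beta> y = (\<integral>x. ewa_density F X lam \<beta> y x *\<^sub>R x \<partial>lborel)"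

text \<open>
  The argument lives in \<open>[0, \<infinity>]\<close>. Since \<open>\<infinity> * t = \<infinity>\<close> for \<open>t > 0\<close>, the supremum
  is \<open>\<infinity>\<close> at \<open>a = \<infinity>\<close>.
\<close>

definition mono_conj :: "(real \<Rightarrow> real) \<Rightarrow> ereal \<Rightarrow> ereal" where
  "mono_conj \<phi> a = (SUP t\<in>{0..}. a * ereal t - ereal (\<phi> t))"

definition orth_proj :: "(real ^ 'p) set \<Rightarrow> real ^ 'p \<Rightarrow> real ^ 'p" where
  "orth_proj T w = (THE z. z \<in> T \<and> w - z \<in> orthogonal_comp T)"

definition proj_norm_2_1 :: "(real ^ 'p) set \<Rightarrow> real" where
  "proj_norm_2_1 T = (SUP w\<in>cball 0 1. l1_norm (orth_proj T w))"

text \<open>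
  The infimum is taken in \<^typ>\<open>ereal\<close>, so it is \<open>\<infinity>\<close> over the empty set; the
  denominator is positive on the index set.
\<close>

definition Upsilon :: "real ^ 'p ^ 'n \<Rightarrow> (real ^ 'p) set \<Rightarrow> real \<Rightarrow> ereal" where
  "Upsilon X T c =
     (INF w\<in>{w. l1_norm (orth_proj (orthogonal_comp T) w) < c * l1_norm (orth_proj T w)}.
        ereal (proj_norm_2_1 T * norm (X *v w) /
          (sqrt (real CARD('n)) *
             (l1_norm (orth_proj T w) - l1_norm (orth_proj (orthogonal_comp T) w) / c))))"

text \<open>
  Division on \<^typ>\<open>ereal\<close> satisfies \<open>a / \<infinity> = 0\<close> for finite \<open>a\<close> and
  \<open>a / 0 = \<infinity>\<close> for \<open>a > 0\<close>. For empty \<open>I\<close> the quotient is \<open>0 / \<infinity> = 0\<close>.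
\<close>

definition oracle_bound ::
  "(real ^ 'n \<Rightarrow> real ^ 'n \<Rightarrow> real) \<Rightarrow> real ^ 'p ^ 'n \<Rightarrow> (real \<Rightarrow> real) \<Rightarrow> real \<Rightarrow> real \<Rightarrow>
     real ^ 'n \<Rightarrow> real ^ 'p \<Rightarrow> ereal" where
  "oracle_bound F X \<phi> lam \<tau> y x0 =
     (INF (I, x)\<in>{(I, x). supp x = I}.
        ereal (excess_loss F X y x x0) +
        ereal (1 / real CARD('n)) *
          mono_conj \<phi>
            (ereal (lam * sqrt (real CARD('n)) * (\<tau> + 1) * sqrt (real (card I))) /
             (ereal \<tau> * Upsilon X (span ((\<lambda>i. axis i 1) ` I)) ((\<tau> + 1) / (\<tau> - 1)))))"

end

theory Submission
  imports Defs
begin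

text \<open>
  Write \<open>V(x) = F(X x, y) / n + \<lambda> \<parallel>x\<parallel>\<^sub>1\<close>. The bounds hold on the event that all coordinates of the
  score \<open>X\<^sup>T \<nabla>F(X x0, y) / n\<close> are at most \<open>\<lambda> / \<tau>\<close> in absolute value.

  The event is likely: \<open>X\<close> is surjective, so \<open>X x0\<close> minimizes the risk over the whole space and each
  \<open>f\<^sub>i'((X x0)\<^sub>i, y\<^sub>i)\<close> is centred (\<open>expected_directional_derivative_nonneg\<close>); Bernstein's inequality and
  a union bound over the columns of \<open>X\<close> finish (\<open>design_noise_bound\<close>).

  On the event, fix a comparison point \<open>z\<close> with support \<open>I\<close> for which the remainder term \<open>B\<close> of
  the bound is finite. Decomposability of the norm, the definition of \<open>\<Upsilon>\<close> and the definition of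
  \<open>\<phi>\<^sup>+\<close> give \<open>\<lambda> (\<parallel>z\<parallel>\<^sub>1 - \<parallel>x\<parallel>\<^sub>1) + (\<lambda> / \<tau>) \<parallel>x - z\<parallel>\<^sub>1 - \<phi>(\<parallel>X (x - z)\<parallel>) / n \<le> B\<close> for every \<open>x\<close>
  (\<open>compatibility_le_mono_conj\<close>). With the strong convexity of \<open>F\<close> this shows that moving \<open>x\<close> to
  \<open>z + s (x - z)\<close> decreases \<open>V\<close> by about \<open>(1 - s) q(x)\<close>, where \<open>q(x)\<close> is an upper bound for
  \<open>R(x, x0) - R(z, x0) - B\<close> (\<open>penalized_dilation\<close>, \<open>excess_loss_diff_le\<close>).

  Both estimators are then treated by letting \<open>s\<close> tend to \<open>1\<close>. At a minimizer of \<open>V\<close> there is no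
  decrease, so \<open>q \<le> 0\<close> there. For the exponential weights, a change of variables shows that the
  contraction multiplies the integral of \<open>exp (- V / \<beta>)\<close> by exactly \<open>s\<^sup>-\<^sup>p\<close>, whence the mean of \<open>q\<close> is
  at most \<open>p \<beta>\<close> (\<open>gibbs_dilation_bound\<close>), and Jensen's inequality passes from the mean of the excess
  loss to the excess loss of the mean.
\<close>

section \<open>The l1 norm, coordinate subspaces and the compatibility constant\<close>

lemma l1_norm_nonneg: "0 \<le> l1_norm x"
  by (simp add: l1_norm_def sum_nonneg)

lemma l1_norm_triangle: "l1_norm (x + y) \<le> l1_norm x + l1_norm y"
  by (simp add: l1_norm_def flip: sum.distrib) (intro sum_mono abs_triangle_ineq)

lemma l1_norm_scaleR: "l1_norm (c *\<^sub>R x) = \<bar>c\<bar> * l1_norm x"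
  by (simp add: l1_norm_def abs_mult sum_distrib_left)

text \<open>
  The vector that agrees with \<open>w\<close> on the coordinates in \<open>I\<close> and vanishes on the others.
\<close>
definition coord_restrict :: "'p set \<Rightarrow> real ^ 'p \<Rightarrow> real ^ 'p" where
  "coord_restrict I w = (\<chi> i. if i \<in> I then w $ i else 0)"

lemma coord_restrict_nth [simp]: "coord_restrict I w $ i = (if i \<in> I then w $ i else 0)"
  by (simp add: coord_restrict_def)

lemma orth_proj_eq:
  fixes T :: "(real ^ 'p) set"
  assumes T: "subspace T" and z: "z \<in> T" and wz: "w - z \<in> orthogonal_comp T"
  shows "orth_proj T w = z"
  unfolding orth_proj_def
proof (rule the_equality)
  show "z \<in> T \<and> w - z \<in> orthogonal_comp T" using z wz by blast
next
  fix z' assume z': "z' \<in> T \<and> w - z' \<in> orthogonal_comp T"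
  have "z - z' \<in> T" using T z z' by (simp add: subspace_diff)
  moreover have "(w - z') - (w - z) \<in> orthogonal_comp T"
    using z' wz subspace_orthogonal_comp subspace_diff by blast
  ultimately have "(z - z') \<bullet> (z - z') = 0"
    by (simp add: orthogonal_comp_def orthogonal_def)
  then show "z' = z" by simp
qed

text \<open>
  The coordinate subspace of \<open>I\<close> and its orthogonal complement: the two projections \<open>\<omega>\<^sub>T\<close>
  and \<open>\<omega>\<^sub>S\<close> are the restrictions to \<open>I\<close> and to its complement.
\<close>
lemma
  fixes w :: "real ^ 'p" and I :: "'p set"
  defines "T \<equiv> span ((\<lambda>i. axis i 1) ` I)"
  shows orth_proj_coord_span: "orth_proj T w = coord_restrict I w"
    and orth_proj_coord_span_comp: "orth_proj (orthogonal_comp T) w = coord_restrict (- I) w"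
proof -
  have 1: "coord_restrict I w \<in> T"
  proof -
    have "coord_restrict I w = (\<Sum>i\<in>I. (w $ i) *\<^sub>R axis i 1)"
      by (simp add: vec_eq_iff axis_def if_distrib cong: if_cong)
    also have "\<dots> \<in> T"
      unfolding T_def by (intro span_sum span_scale span_base) auto
    finally show ?thesis .
  qed
  have 2: "coord_restrict (- I) w \<in> orthogonal_comp T"
    unfolding orthogonal_comp_def T_def
  proof clarify
    fix y assume "y \<in> span ((\<lambda>i. axis i 1) ` I :: (real ^ 'p) set)"
    moreover have "orthogonal (coord_restrict (- I) w) z" if "z \<in> (\<lambda>i. axis i 1) ` I" for z
      using that by (auto simp: orthogonal_def inner_axis)
    ultimately show "orthogonal y (coord_restrict (- I) w)"
      using orthogonal_to_span orthogonal_commute by blast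
  qed
  have 3: "w - coord_restrict I w = coord_restrict (- I) w"
    "w - coord_restrict (- I) w = coord_restrict I w"
    by (simp_all add: vec_eq_iff)
  show "orth_proj T w = coord_restrict I w"
    by (rule orth_proj_eq) (use 1 2 3 in \<open>auto simp: T_def\<close>)
  show "orth_proj (orthogonal_comp T) w = coord_restrict (- I) w"
    by (rule orth_proj_eq)
      (use 1 2 3 orthogonal_comp_subset in \<open>auto simp: subspace_orthogonal_comp\<close>)
qed

lemma l1_norm_coord_restrict_le:
  fixes w :: "real ^ 'p"
  shows "l1_norm (coord_restrict I w) \<le> sqrt (real (card I)) * norm w"
proof -
  have "l1_norm (coord_restrict I w) = (\<Sum>i\<in>I. \<bar>w $ i\<bar>)"
    by (simp add: l1_norm_def if_distrib sum.If_cases cong: if_cong)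
  also have "\<dots> \<le> L2_set (\<lambda>_. 1) I * L2_set (\<lambda>i. w $ i) I"
    using L2_set_mult_ineq[of "\<lambda>_. 1" "\<lambda>i. w $ i" I] by simp
  also have "L2_set (\<lambda>_. 1 :: real) I = sqrt (real (card I))"
    by (simp add: L2_set_def)
  also have "L2_set (\<lambda>i. w $ i) I \<le> norm w"
    unfolding norm_vec_def by (simp add: L2_set_def) (intro sum_mono2, auto)
  finally show ?thesis
    by (simp add: mult_left_mono)
qed

lemma proj_norm_coord_span:
  fixes I :: "('p::finite) set"
  defines "T \<equiv> span ((\<lambda>i. axis i 1) ` I :: (real ^ 'p) set)"
  shows "0 \<le> proj_norm_2_1 T" "proj_norm_2_1 T \<le> sqrt (real (card I))"
proof -
  have le: "l1_norm (orth_proj T w) \<le> sqrt (real (card I))" if "w \<in> cball 0 1" for w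
    using l1_norm_coord_restrict_le[of I w] that
      mult_left_mono[of "norm w" 1 "sqrt (real (card I))"]
    by (simp add: T_def orth_proj_coord_span)
  show "proj_norm_2_1 T \<le> sqrt (real (card I))"
    unfolding proj_norm_2_1_def by (rule cSUP_least) (use le in auto)
  have "0 \<le> l1_norm (orth_proj T 0)" by (rule l1_norm_nonneg)
  also have "\<dots> \<le> proj_norm_2_1 T"
    unfolding proj_norm_2_1_def
    by (rule cSUP_upper) (use le in \<open>auto intro!: bdd_aboveI2\<close>)
  finally show "0 \<le> proj_norm_2_1 T" .
qed

lemma mono_conj_ge:
  assumes "0 \<le> t"
  shows "a * ereal t - ereal (\<phi> t) \<le> mono_conj \<phi> a"
  unfolding mono_conj_def by (rule SUP_upper) (use assms in auto)

lemma mono_conj_nonneg: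
  assumes "\<phi> 0 = 0"
  shows "0 \<le> mono_conj \<phi> a"
  using mono_conj_ge[of 0 a \<phi>] assms by (simp flip: zero_ereal_def)

text \<open>
  This is how \<^const>\<open>Upsilon\<close> and the monotone conjugate enter. If the bracket
  \<open>d = \<parallel>w\<^sub>I\<parallel>\<^sub>1 - \<parallel>w\<^sub>-\<^sub>I\<parallel>\<^sub>1 / c\<close> is positive, then \<open>w\<close> is admissible in the infimum defining \<open>\<Upsilon>\<close>,
  so \<open>d\<close> is at most a multiple of \<open>\<parallel>X w\<parallel>\<close> unless \<open>\<Upsilon> = 0\<close>, and the Young inequality
  \<open>a t \<le> \<phi> t + \<phi>\<^sup>+ a\<close> with \<open>t = \<parallel>X w\<parallel>\<close> applies. If \<open>d\<close> is not positive, the left-hand side is not positive either.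
\<close>
lemma compatibility_le_mono_conj:
  fixes X :: "real ^ 'p ^ 'n" and I :: "'p set" and \<phi> :: "real \<Rightarrow> real" and w :: "real ^ 'p"
  assumes \<phi>0: "\<phi> 0 = 0" and \<phi>nn: "\<And>t. 0 \<le> t \<Longrightarrow> 0 \<le> \<phi> t"
    and c: "0 < c" and lam: "0 < lam" and tau: "1 < \<tau>"
  shows "ereal (lam * (\<tau> + 1) / \<tau> * (l1_norm (coord_restrict I w) - l1_norm (coord_restrict (- I) w) / c)
            - \<phi> (norm (X *v w)) / real CARD('n))
    \<le> ereal (1 / real CARD('n)) * mono_conj \<phi>
         (ereal (lam * sqrt (real CARD('n)) * (\<tau> + 1) * sqrt (real (card I))) /
          (ereal \<tau> * Upsilon X (span ((\<lambda>i. axis i 1) ` I)) c))"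
    (is "ereal (?k * ?d - ?f / ?n) \<le> ereal (1 / ?n) * mono_conj \<phi> ?a")
proof (cases "?d \<le> 0")
  case True
  have "?k * ?d \<le> 0" using True lam tau by (intro mult_nonneg_nonpos) auto
  moreover have "0 \<le> ?f / ?n" using \<phi>nn by simp
  ultimately have "ereal (?k * ?d - ?f / ?n) \<le> 0" by simp
  also have "0 \<le> ereal (1 / ?n) * mono_conj \<phi> ?a"
    using mono_conj_nonneg[of \<phi>, OF \<phi>0] by (intro ereal_0_le_mult) auto
  finally show ?thesis .
next
  case False
  define T where "T = span ((\<lambda>i. axis i 1) ` I :: (real ^ 'p) set)"
  define U where "U = Upsilon X T c"
  define s where "s = sqrt (real (card I))"
  define r where "r = norm (X *v w)"
  note P = orth_proj_coord_span[of I, folded T_def] orth_proj_coord_span_comp[of I, folded T_def]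
  note N = proj_norm_coord_span[of I, folded T_def s_def]
  have d: "0 < ?d" using False by simp
  have n: "0 < ?n" by simp
  have s0: "0 < s"
  proof -
    have "0 < l1_norm (coord_restrict I w)"
      using d l1_norm_nonneg[of "coord_restrict (- I) w"] c
      by (smt (verit) divide_nonneg_pos)
    then show ?thesis using l1_norm_coord_restrict_le[of I w]
      by (cases "card I") (auto simp: s_def)
  qed
  have U0: "0 \<le> U"
    unfolding U_def Upsilon_def P
  proof (rule INF_greatest, clarify)
    fix v assume v: "l1_norm (coord_restrict (- I) v) < c * l1_norm (coord_restrict I v)"
    show "0 \<le> ereal (proj_norm_2_1 T * norm (X *v v) / (sqrt ?n *
        (l1_norm (coord_restrict I v) - l1_norm (coord_restrict (- I) v) / c)))"
      using v c N by (simp add: divide_simps mult.commute)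
  qed
  have Ule: "U \<le> ereal (s * r / (sqrt ?n * ?d))"
  proof -
    have "U \<le> ereal (proj_norm_2_1 T * norm (X *v w) / (sqrt ?n * ?d))"
      unfolding U_def Upsilon_def P
      by (rule INF_lower) (use d c in \<open>auto simp: divide_simps mult.commute\<close>)
    also have "\<dots> \<le> ereal (s * r / (sqrt ?n * ?d))"
      using N d by (auto simp: r_def intro!: divide_right_mono mult_right_mono)
    finally show ?thesis .
  qed
  then obtain u where u: "U = ereal u" using U0 by (cases U) auto
  have a: "?a = ereal (lam * sqrt ?n * (\<tau> + 1) * s) / ereal (\<tau> * u)"
    by (simp add: T_def[symmetric] U_def[symmetric] u s_def)
  have num: "0 < lam * sqrt ?n * (\<tau> + 1) * s"
    using lam tau s0 by simp
  have u0: "0 \<le> u" using U0 u by simp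
  show ?thesis
  \<comment> \<open>If \<open>\<Upsilon> = 0\<close>, then the argument of the conjugate is \<open>\<infinity>\<close>, and so is its value.\<close>
  proof (cases "u = 0")
    case True
    have "\<tau> + 1 \<noteq> 0" using tau by simp
    then have "?a = \<infinity>" using num s0 lam unfolding a True by (simp add: zero_ereal_def[symmetric] divide_ereal_def)
    then have "\<infinity> \<le> mono_conj \<phi> ?a"
      using mono_conj_ge[of 1 ?a \<phi>] by simp
    then have "mono_conj \<phi> ?a = \<infinity>" by simp
    then show ?thesis using n by simp
  next
    case False
    then have up: "0 < u" using u0 by simp
    define A where "A = lam * sqrt ?n * (\<tau> + 1) * s / (\<tau> * u)"
    have aA: "?a = ereal A" using up tau unfolding a A_def by simp
    have "u * (sqrt ?n * ?d) \<le> s * r"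
      using Ule d n unfolding u by (simp add: pos_le_divide_eq)
    then have "sqrt ?n * (u * (sqrt ?n * ?d)) \<le> sqrt ?n * (s * r)"
      by (rule mult_left_mono) simp
    moreover have "sqrt ?n * (u * (sqrt ?n * ?d)) = ?n * u * ?d"
      using real_sqrt_mult_self[of ?n] by (simp add: algebra_simps)
    ultimately have 1: "?n * u * ?d \<le> sqrt ?n * (s * r)" by simp
    have "?n * (?k * ?d) = lam * (\<tau> + 1) / (\<tau> * u) * (?n * u * ?d)"
      using up tau by (simp add: field_simps)
    also have "\<dots> \<le> lam * (\<tau> + 1) / (\<tau> * u) * (sqrt ?n * (s * r))"
      by (rule mult_left_mono[OF 1]) (use lam tau up in auto)
    also have "\<dots> = A * r" by (simp add: A_def)
    finally have 2: "?n * (?k * ?d) \<le> A * r" .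
    have 3: "ereal (A * r - \<phi> r) \<le> mono_conj \<phi> ?a"
      using mono_conj_ge[of r ?a \<phi>] unfolding aA by (simp add: r_def)
    have "?k * ?d - ?f / ?n = (1 / ?n) * (?n * (?k * ?d) - \<phi> r)"
      by (simp add: r_def right_diff_distrib)
    also have "\<dots> \<le> (1 / ?n) * (A * r - \<phi> r)"
      by (rule mult_left_mono) (use 2 in auto)
    finally have "ereal (?k * ?d - ?f / ?n) \<le> ereal (1 / ?n) * ereal (A * r - \<phi> r)" by simp
    also have "\<dots> \<le> ereal (1 / ?n) * mono_conj \<phi> ?a"
      by (rule ereal_mult_left_mono[OF 3]) simp
    finally show ?thesis .
  qed
qed

text \<open>
  Decomposability of the \<open>\<ell>\<^sub>1\<close> norm over the support of \<open>z\<close>; it produces the cone constant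
  \<open>(\<tau> + 1) / (\<tau> - 1)\<close>.
\<close>
lemma l1_penalty_decomposition:
  fixes x z :: "real ^ 'p"
  assumes lam: "0 < lam" and tau: "1 < \<tau>" and I: "I = supp z"
  shows "lam * (l1_norm z - l1_norm x) + lam / \<tau> * l1_norm (x - z)
     \<le> lam * (\<tau> + 1) / \<tau> * (l1_norm (coord_restrict I (x - z))
          - l1_norm (coord_restrict (- I) (x - z)) / ((\<tau> + 1) / (\<tau> - 1)))"
proof -
  have "\<tau> + 1 \<noteq> 0" using tau by simp
  let ?t = "l1_norm (coord_restrict I (x - z))" and ?s = "l1_norm (coord_restrict (- I) (x - z))"
  have split: "l1_norm v = l1_norm (coord_restrict I v) + l1_norm (coord_restrict (- I) v)" for v :: "real ^ 'p"
    unfolding l1_norm_def sum.distrib[symmetric] by (intro sum.cong) auto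
  have "l1_norm z - l1_norm x \<le> ?t - ?s"
    unfolding l1_norm_def sum_subtractf[symmetric]
    by (intro sum_mono) (auto simp: I supp_def)
  then have "lam * (l1_norm z - l1_norm x) + lam / \<tau> * l1_norm (x - z) \<le> lam * (?t - ?s) + lam / \<tau> * (?t + ?s)"
    unfolding split[of "x - z"] using lam by simp
  also have "\<dots> = lam / \<tau> * ((\<tau> + 1) * ?t - (\<tau> - 1) * ?s)"
    using tau by (simp add: field_simps)
  also have "(\<tau> + 1) * ?t - (\<tau> - 1) * ?s = (\<tau> + 1) * (?t - ?s / ((\<tau> + 1) / (\<tau> - 1)))"
  proof -
    have "e * (t - s / (e / f)) = e * t - f * s" if "e \<noteq> 0" for e f s t :: real
      using that by (simp add: right_diff_distrib)
    then show ?thesis using \<open>\<tau> + 1 \<noteq> 0\<close> by metis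
  qed
  finally show ?thesis by simp
qed

section \<open>Gibbs means and dilations\<close>

lemma l1_norm_eq_sum_Basis:
  fixes x :: "real ^ 'p"
  shows "l1_norm x = (\<Sum>b\<in>Basis. \<bar>x \<bullet> b\<bar>)"
proof -
  have inj: "inj (\<lambda>i::'p. axis i (1::real))"
    by (simp add: inj_on_def axis_eq_axis)
  have B: "(Basis :: (real ^ 'p) set) = range (\<lambda>i. axis i 1)"
    by (auto simp: Basis_vec_def)
  have "(\<Sum>b\<in>Basis. \<bar>x \<bullet> b\<bar>) = (\<Sum>i\<in>UNIV. \<bar>x \<bullet> axis i 1\<bar>)"
    unfolding B sum.reindex[OF inj] by simp
  then show ?thesis by (simp add: l1_norm_def inner_axis)
qed

lemma continuous_on_l1_norm [continuous_intros]:
  "continuous_on S f \<Longrightarrow> continuous_on S (\<lambda>x. l1_norm (f x))"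
  unfolding l1_norm_def by (intro continuous_intros)

lemma borel_measurable_l1_norm [measurable]: "l1_norm \<in> borel_measurable borel"
  by (intro borel_measurable_continuous_onI continuous_intros)

lemma nn_integral_exp_abs_finite:
  fixes a :: real
  assumes a: "0 < a"
  shows "(\<integral>\<^sup>+x. ennreal (exp (- a * \<bar>x\<bar>)) \<partial>lborel) < \<infinity>"
proof -
  have 1: "(\<integral>\<^sup>+x. ennreal (exponential_density a x) \<partial>lborel) = 1"
    using prob_space.emeasure_space_1[OF prob_space_exponential_density[OF a]]
    by (simp add: emeasure_density)
  have 2: "(\<integral>\<^sup>+x. ennreal (exponential_density a (- x)) \<partial>lborel) = 1"
    using nn_integral_real_affine[of "\<lambda>x. ennreal (exponential_density a x)" "-1" 0] 1 by simp
  have "(\<integral>\<^sup>+x. ennreal (exp (- a * \<bar>x\<bar>)) \<partial>lborel)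
      \<le> (\<integral>\<^sup>+x. ennreal (1 / a) * (ennreal (exponential_density a x) + ennreal (exponential_density a (- x))) \<partial>lborel)"
  proof (rule nn_integral_mono)
    fix x :: real
    have "exp (- a * \<bar>x\<bar>) \<le> (1 / a) * (exponential_density a x + exponential_density a (- x))"
      using a by (auto simp: exponential_density_def erlang_density_def field_simps abs_if)
    then show "ennreal (exp (- a * \<bar>x\<bar>)) \<le> ennreal (1 / a) * (ennreal (exponential_density a x) + ennreal (exponential_density a (- x)))"
      using a by (simp add: exponential_density_nonneg flip: ennreal_plus ennreal_mult)
  qed
  also have "\<dots> = ennreal (1 / a) * (1 + 1)"
    by (simp add: nn_integral_cmult nn_integral_add 1 2)
  also have "\<dots> < \<infinity>" by (simp add: ennreal_mult_less_top)
  finally show ?thesis .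
qed

lemma integrable_exp_l1_norm:
  assumes a: "0 < a"
  shows "integrable lborel (\<lambda>x. exp (- a * l1_norm x))"
proof (rule integrableI_bounded)
  show "(\<lambda>x. exp (- a * l1_norm x)) \<in> borel_measurable lborel" by measurable
  have "(\<integral>\<^sup>+x. ennreal (norm (exp (- a * l1_norm (x :: real ^ 'a)))) \<partial>lborel)
      = (\<integral>\<^sup>+x. (\<Prod>b\<in>Basis. ennreal (exp (- a * \<bar>(x :: real ^ 'a) \<bullet> b\<bar>))) \<partial>lborel)"
    by (intro nn_integral_cong)
      (simp add: l1_norm_eq_sum_Basis sum_distrib_left exp_sum prod_ennreal prod_nonneg flip: sum_negf)
  also have "\<dots> = (\<Prod>b\<in>(Basis :: (real^'a) set). (\<integral>\<^sup>+x. ennreal (exp (- a * \<bar>x\<bar>)) \<partial>lborel))"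
    by (rule nn_integral_lborel_prod) auto
  also have "\<dots> < \<infinity>"
    using nn_integral_exp_abs_finite[OF a] by (simp add: power_less_top_ennreal)
  finally show "(\<integral>\<^sup>+x. ennreal (norm (exp (- a * l1_norm (x :: real ^ 'a)))) \<partial>lborel) < \<infinity>" .
qed

text \<open>
  A potential with linear growth has an integrable Gibbs weight, against which the potential
  itself and the norm are integrable as well.
\<close>
lemma
  fixes V :: "real ^ 'p \<Rightarrow> real"
  assumes V [measurable]: "V \<in> borel_measurable borel"
    and lower: "\<And>x. c + a * l1_norm x \<le> V x" and a: "0 < a" and b: "0 < \<beta>"
  shows integrable_gibbs: "integrable lborel (\<lambda>x. exp (- V x / \<beta>))"
    and integrable_gibbs_energy: "integrable lborel (\<lambda>x. exp (- V x / \<beta>) * V x)"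
    and integrable_gibbs_l1_norm: "integrable lborel (\<lambda>x. exp (- V x / \<beta>) * l1_norm x)"
proof -
  have I: "integrable lborel (\<lambda>x. exp (- V x / b))" if b: "0 < b" for b
  proof (rule Bochner_Integration.integrable_bound)
    show "integrable lborel (\<lambda>x::real^'p. exp (- c / b) * exp (- (a / b) * l1_norm x))"
      using a b by (intro integrable_mult_right integrable_exp_l1_norm) simp
    have "exp (- V x / b) \<le> exp (- c / b) * exp (- (a / b) * l1_norm x)" for x
      using lower[of x] b by (simp add: field_simps flip: exp_add)
    then show "AE x in lborel. norm (exp (- V x / b)) \<le> norm (exp (- c / b) * exp (- (a / b) * l1_norm x))"
      by simp
  qed simp
  then show I1: "integrable lborel (\<lambda>x. exp (- V x / \<beta>))" using b .
  show I2: "integrable lborel (\<lambda>x. exp (- V x / \<beta>) * V x)"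
  proof (rule Bochner_Integration.integrable_bound)
    show "integrable lborel (\<lambda>x. 2 * \<beta> * exp (- V x / (2 * \<beta>)) + \<bar>c\<bar> * exp (- V x / \<beta>))"
      using b by (intro Bochner_Integration.integrable_add integrable_mult_right I) auto
    have "\<bar>exp (- V x / \<beta>) * V x\<bar> \<le> 2 * \<beta> * exp (- V x / (2 * \<beta>)) + \<bar>c\<bar> * exp (- V x / \<beta>)" for x
    proof -
      have "c \<le> V x" using lower[of x] l1_norm_nonneg[of x] a
        by (smt (verit) mult_nonneg_nonneg)
      moreover have "V x \<le> 2 * \<beta> * exp (V x / (2 * \<beta>))"
      proof -
        have "V x / (2 * \<beta>) \<le> exp (V x / (2 * \<beta>))" using exp_ge_add_one_self[of "V x / (2 * \<beta>)"] by linarith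
        then show ?thesis using b by (simp add: field_simps)
      qed
      moreover have "0 \<le> 2 * \<beta> * exp (V x / (2 * \<beta>))" using b by simp
      ultimately have "\<bar>V x\<bar> \<le> 2 * \<beta> * exp (V x / (2 * \<beta>)) + \<bar>c\<bar>" by linarith
      then have "exp (- V x / \<beta>) * \<bar>V x\<bar> \<le> exp (- V x / \<beta>) * (2 * \<beta> * exp (V x / (2 * \<beta>)) + \<bar>c\<bar>)"
        by (rule mult_left_mono) simp
      also have "exp (- V x / \<beta>) * (2 * \<beta> * exp (V x / (2 * \<beta>)) + \<bar>c\<bar>)
        = 2 * \<beta> * (exp (- V x / \<beta>) * exp (V x / (2 * \<beta>))) + \<bar>c\<bar> * exp (- V x / \<beta>)"
        by (simp add: algebra_simps)
      also have "exp (- V x / \<beta>) * exp (V x / (2 * \<beta>)) = exp (- V x / (2 * \<beta>))"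
        by (simp flip: exp_add)
      finally show ?thesis by (simp add: abs_mult)
    qed
    then show "AE x in lborel. norm (exp (- V x / \<beta>) * V x) \<le> norm (2 * \<beta> * exp (- V x / (2 * \<beta>)) + \<bar>c\<bar> * exp (- V x / \<beta>))"
      by (intro AE_I2) (metis real_norm_def abs_ge_self order_trans)
  qed simp
  show "integrable lborel (\<lambda>x. exp (- V x / \<beta>) * l1_norm x)"
  proof (rule Bochner_Integration.integrable_bound)
    show "integrable lborel (\<lambda>x. 1 / a * (exp (- V x / \<beta>) * V x - c * exp (- V x / \<beta>)))"
      using I1 I2 by simp
    have "\<bar>exp (- V x / \<beta>) * l1_norm x\<bar> \<le> 1 / a * (exp (- V x / \<beta>) * V x - c * exp (- V x / \<beta>))" for x
    proof -
      have "l1_norm x \<le> 1 / a * (V x - c)" using lower[of x] a by (simp add: field_simps)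
      then have "exp (- V x / \<beta>) * l1_norm x \<le> exp (- V x / \<beta>) * (1 / a * (V x - c))"
        by (rule mult_left_mono) simp
      then show ?thesis using l1_norm_nonneg[of x] by (simp add: abs_mult right_diff_distrib mult.commute diff_divide_distrib)
    qed
    then show "AE x in lborel. norm (exp (- V x / \<beta>) * l1_norm x) \<le> norm (1 / a * (exp (- V x / \<beta>) * V x - c * exp (- V x / \<beta>)))"
      by (intro AE_I2) (metis real_norm_def abs_ge_self order_trans)
  qed simp
qed

lemma
  fixes f :: "'a::euclidean_space \<Rightarrow> real"
  assumes f: "integrable lborel f" and s: "0 < s"
  shows integrable_lborel_dilation: "integrable lborel (\<lambda>x. f (z + s *\<^sub>R (x - z)))"
    and integral_lborel_dilation:
      "s ^ DIM('a) * (\<integral>x. f (z + s *\<^sub>R (x - z)) \<partial>lborel) = (\<integral>x. f x \<partial>lborel)"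
proof -
  have [measurable]: "f \<in> borel_measurable borel"
    using borel_measurable_integrable[OF f] by simp
  let ?t = "z - s *\<^sub>R z"
  have T: "z + s *\<^sub>R (x - z) = ?t + s *\<^sub>R x" for x by (simp add: algebra_simps)
  have L: "(lborel :: 'a measure) = density (distr lborel borel (\<lambda>x. ?t + s *\<^sub>R x)) (\<lambda>_. ennreal (s ^ DIM('a)))"
    using lborel_affine[of s ?t] s by simp
  have "integrable (density (distr lborel borel (\<lambda>x. ?t + s *\<^sub>R x)) (\<lambda>_. ennreal (s ^ DIM('a)))) f"
    using f by (simp flip: L)
  then show "integrable lborel (\<lambda>x. f (z + s *\<^sub>R (x - z)))"
    using s by (simp add: integrable_density integrable_distr_eq T)
  have "(\<integral>x. f x \<partial>lborel) = (\<integral>x. f x \<partial>density (distr lborel borel (\<lambda>x. ?t + s *\<^sub>R x)) (\<lambda>_. ennreal (s ^ DIM('a))))"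
    by (simp flip: L)
  also have "\<dots> = s ^ DIM('a) * (\<integral>x. f (z + s *\<^sub>R (x - z)) \<partial>lborel)"
    using s by (simp add: integral_density integral_distr T)
  finally show "s ^ DIM('a) * (\<integral>x. f (z + s *\<^sub>R (x - z)) \<partial>lborel) = (\<integral>x. f x \<partial>lborel)" by simp
qed

text \<open>
  Suppose that \<open>V\<close> drops by at least \<open>(1 - s) q\<close>, to first order, when points are contracted
  towards \<open>z\<close> by the factor \<open>s\<close>. Comparing the integral of the Gibbs weight with that of the
  contracted weight, which is larger by the factor \<open>s\<^sup>-\<^sup>d\<close>, bounds the Gibbs mean of \<open>s q + (1 - s) r\<close>
  by \<open>\<beta> (s\<^sup>-\<^sup>d - 1) / (1 - s)\<close>, hence that of \<open>q\<close> by \<open>d \<beta>\<close> in the limit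
  \<open>s \<rightarrow> 1\<close>. This is the integration by parts
  \<open>\<integral> \<langle>\<nabla>V(x), x - z\<rangle> \<mu>(dx) = d \<beta>\<close> in a form that needs no derivative of \<open>V\<close>. The function \<open>r\<close>
  carries an error of order \<open>(1 - s)\<^sup>2\<close>.
\<close>
lemma gibbs_dilation_bound:
  fixes V q r :: "'a::euclidean_space \<Rightarrow> real"
  assumes b: "0 < \<beta>"
    and w: "integrable lborel (\<lambda>x. exp (- V x / \<beta>))"
    and q: "integrable lborel (\<lambda>x. exp (- V x / \<beta>) * q x)"
    and r: "integrable lborel (\<lambda>x. exp (- V x / \<beta>) * r x)"
    and dil: "\<And>s x. 0 < s \<Longrightarrow> s < 1 \<Longrightarrow>
      V (z + s *\<^sub>R (x - z)) \<le> V x - (1 - s) * (s * q x + (1 - s) * r x)"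
  shows "(\<integral>x. exp (- V x / \<beta>) * q x \<partial>lborel)
    \<le> real DIM('a) * \<beta> * (\<integral>x. exp (- V x / \<beta>) \<partial>lborel)"
proof -
  let ?w = "\<lambda>x. exp (- V x / \<beta>)" and ?d = "DIM('a)"
  define Z where "Z = (\<integral>x. ?w x \<partial>lborel)"
  define Q where "Q = (\<integral>x. ?w x * q x \<partial>lborel)"
  define R where "R = (\<integral>x. ?w x * r x \<partial>lborel)"
  have key: "s ^ ?d * (s * Q + (1 - s) * R) \<le> \<beta> * Z * (\<Sum>k<?d. s ^ k)" if s: "0 < s" "s < 1" for s
  proof -
    define h where "h x = ?w x + (1 - s) / \<beta> * (s * (?w x * q x) + (1 - s) * (?w x * r x))" for x
    have h: "integrable lborel h" "(\<integral>x. h x \<partial>lborel) = Z + (1 - s) / \<beta> * (s * Q + (1 - s) * R)"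
      using w q r by (simp_all add: h_def[abs_def] Z_def Q_def R_def)
    \<comment> \<open>The inequality \<open>1 + u \<le> exp u\<close> linearises the gain of the contraction.\<close>
    have hle: "h x \<le> ?w (z + s *\<^sub>R (x - z))" for x
    proof -
      let ?u = "(1 - s) / \<beta> * (s * q x + (1 - s) * r x)"
      have "h x = ?w x * (1 + ?u)" by (simp add: h_def algebra_simps)
      also have "\<dots> \<le> ?w x * exp ?u"
        by (intro mult_left_mono exp_ge_add_one_self) simp
      also have "\<dots> = exp (- (V x - (1 - s) * (s * q x + (1 - s) * r x)) / \<beta>)"
        using b by (simp add: exp_add[symmetric] field_simps)
      also have "\<dots> \<le> ?w (z + s *\<^sub>R (x - z))"
      proof -
        have "- (V x - (1 - s) * (s * q x + (1 - s) * r x)) \<le> - V (z + s *\<^sub>R (x - z))"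
          using dil[OF s, of x] by linarith
        then show ?thesis using b by (intro exp_le_cancel_iff[THEN iffD2] divide_right_mono) auto
      qed
      finally show ?thesis .
    qed
    have "(\<integral>x. h x \<partial>lborel) \<le> (\<integral>x. ?w (z + s *\<^sub>R (x - z)) \<partial>lborel)"
      by (rule integral_mono[OF h(1) integrable_lborel_dilation[OF w s(1)] hle])
    then have "s ^ ?d * (Z + (1 - s) / \<beta> * (s * Q + (1 - s) * R)) \<le> Z"
      using integral_lborel_dilation[OF w s(1), of z] s unfolding h Z_def[symmetric]
      by (metis mult_left_mono zero_le_power less_imp_le)
    then have "(1 - s) / \<beta> * (s ^ ?d * (s * Q + (1 - s) * R)) \<le> Z * (1 - s ^ ?d)"
      unfolding right_diff_distrib[of Z] distrib_left[of "s ^ ?d" Z] by (simp add: mult_ac)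
    also have "\<dots> = (1 - s) / \<beta> * (\<beta> * Z * (\<Sum>k<?d. s ^ k))"
      using b by (simp add: one_diff_power_eq)
    finally show ?thesis
      by (rule mult_left_le_imp_le) (use s b in simp)
  qed
  have "((\<lambda>s. s ^ ?d * (s * Q + (1 - s) * R)) \<longlongrightarrow> 1 ^ ?d * (1 * Q + (1 - 1) * R)) (at_left 1)"
    by (intro tendsto_intros)
  moreover have "((\<lambda>s. \<beta> * Z * (\<Sum>k<?d. s ^ k)) \<longlongrightarrow> \<beta> * Z * (\<Sum>k<?d. 1 ^ k)) (at_left 1)"
    by (intro tendsto_intros)
  moreover have "eventually (\<lambda>s::real. 0 < s \<and> s < 1) (at_left 1)"
    using eventually_at_left_real[of 0 1] by simp
  then have "eventually (\<lambda>s. s ^ ?d * (s * Q + (1 - s) * R) \<le> \<beta> * Z * (\<Sum>k<?d. s ^ k)) (at_left 1)"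
    by (rule eventually_mono) (use key in auto)
  ultimately have "1 ^ ?d * (1 * Q + (1 - 1) * R) \<le> \<beta> * Z * (\<Sum>k<?d. 1 ^ k)"
    by (intro tendsto_le[of "at_left (1::real)"]) auto
  then show ?thesis by (simp add: Q_def Z_def mult_ac)
qed

section \<open>Oracle inequalities on the noise event\<close>

text \<open>
  The two first-order lower bounds based at the intermediate point, averaged with weights
  \<open>1 - s\<close> and \<open>s\<close>; the gradient terms cancel, and one of the two \<open>\<phi>\<close> terms is kept.
\<close>
lemma uniformly_convex_interpolation:
  fixes L :: "'a::real_inner \<Rightarrow> real" and D :: "'a \<Rightarrow> 'a"
  assumes L: "\<And>u v. L u + D u \<bullet> (v - u) + \<phi> (norm (v - u)) \<le> L v"
    and \<phi>: "\<And>t. 0 \<le> t \<Longrightarrow> 0 \<le> \<phi> t" and s: "0 \<le> s" "s \<le> 1"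
  shows "L (u + s *\<^sub>R (v - u)) + (1 - s) * \<phi> (s * norm (v - u)) \<le> s * L v + (1 - s) * L u"
proof -
  let ?m = "u + s *\<^sub>R (v - u)"
  have "u - ?m = - s *\<^sub>R (v - u)" "v - ?m = (1 - s) *\<^sub>R (v - u)"
    by (simp_all add: algebra_simps)
  then have 1: "L ?m - s * (D ?m \<bullet> (v - u)) + \<phi> (s * norm (v - u)) \<le> L u"
    and 2: "L ?m + (1 - s) * (D ?m \<bullet> (v - u)) + \<phi> ((1 - s) * norm (v - u)) \<le> L v"
    using L[of ?m u] L[of ?m v] s by simp_all
  have "0 \<le> \<phi> ((1 - s) * norm (v - u))" using \<phi> s by simp
  then have 3: "L ?m + (1 - s) * (D ?m \<bullet> (v - u)) \<le> L v" using 2 by simp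
  have "(1 - s) * (L ?m - s * (D ?m \<bullet> (v - u)) + \<phi> (s * norm (v - u)))
      + s * (L ?m + (1 - s) * (D ?m \<bullet> (v - u))) \<le> (1 - s) * L u + s * L v"
    using 1 3 s by (intro add_mono mult_left_mono) auto
  then show ?thesis by (simp add: algebra_simps)
qed

text \<open>
  The key inequality. When \<open>x\<close> is contracted towards \<open>z\<close>, the penalized loss drops by at least
  \<open>(1 - s) (s q x + (1 - s) r x)\<close>, where \<open>q x = G x - G z - B + k \<parallel>x - z\<parallel>\<^sub>1\<close> with
  \<open>G x = F (X x) y / n\<close>; the bound \<open>q \<le> 0\<close> is the wanted comparison with \<open>z\<close>. Estimating the
  strong convexity term through \<open>B\<close> leaves only functions that are linear in the loss and
  the norms.
\<close>
lemma penalized_dilation: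
  fixes X :: "real ^ 'p ^ 'n" and F :: "real ^ 'n \<Rightarrow> real ^ 'n \<Rightarrow> real"
  assumes L: "\<And>u v. F u y + gradient (\<lambda>u. F u y) u \<bullet> (v - u) + \<phi> (norm (v - u)) \<le> F v y"
    and \<phi>: "\<And>t. 0 \<le> t \<Longrightarrow> 0 \<le> \<phi> t" and lam: "0 < lam"
    and B: "\<And>x. lam * (l1_norm z - l1_norm x) + k * l1_norm (x - z)
        - \<phi> (norm (X *v (x - z))) / real CARD('n) \<le> B"
    and s: "0 < s" "s < 1"
  shows "penalized F X lam y (z + s *\<^sub>R (x - z)) \<le> penalized F X lam y x - (1 - s) *
     (s * (F (X *v x) y / real CARD('n) - F (X *v z) y / real CARD('n) - B + k * l1_norm (x - z))
      + (1 - s) * (F (X *v x) y / real CARD('n) - F (X *v z) y / real CARD('n) - B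
          + lam * (l1_norm x - l1_norm z)))"
proof -
  let ?n = "real CARD('n)" and ?m = "z + s *\<^sub>R (x - z)"
  let ?f = "\<phi> (s * norm (X *v (x - z))) / ?n"
  let ?G = "\<lambda>x. F (X *v x) y / ?n"
  have Xm: "X *v ?m = X *v z + s *\<^sub>R (X *v x - X *v z)"
    by (simp add: matrix_vector_right_distrib matrix_vector_mult_diff_distrib matrix_vector_mult_scaleR)
  have "F (X *v ?m) y + (1 - s) * \<phi> (s * norm (X *v (x - z))) \<le> s * F (X *v x) y + (1 - s) * F (X *v z) y"
    using uniformly_convex_interpolation[where L="\<lambda>u. F u y", OF L \<phi>, of s "X *v z" "X *v x"] s
    unfolding Xm by (simp add: matrix_vector_mult_diff_distrib)
  then have "(F (X *v ?m) y + (1 - s) * \<phi> (s * norm (X *v (x - z)))) / ?n \<le> (s * F (X *v x) y + (1 - s) * F (X *v z) y) / ?n"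
    by (rule divide_right_mono) simp
  then have G: "?G ?m + (1 - s) * ?f \<le> s * ?G x + (1 - s) * ?G z"
    by (simp add: add_divide_distrib)
  have "?m = s *\<^sub>R x + (1 - s) *\<^sub>R z" by (simp add: algebra_simps)
  then have l1: "l1_norm ?m \<le> s * l1_norm x + (1 - s) * l1_norm z"
    using l1_norm_triangle[of "s *\<^sub>R x" "(1 - s) *\<^sub>R z"] s by (simp add: l1_norm_scaleR)
  \<comment> \<open>The hypothesis on \<open>B\<close> is used at the contracted point, where its \<open>\<phi>\<close> term is the one gained above.\<close>
  have "?m - z = s *\<^sub>R (x - z)" by simp
  then have "lam * (l1_norm z - l1_norm ?m) + k * (s * l1_norm (x - z)) - ?f \<le> B"
    using B[of ?m] s by (simp add: l1_norm_scaleR matrix_vector_mult_scaleR)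
  moreover have "lam * (s * (l1_norm z - l1_norm x)) \<le> lam * (l1_norm z - l1_norm ?m)"
    using l1 lam by (intro mult_left_mono) (auto simp: algebra_simps)
  ultimately have "lam * (s * (l1_norm z - l1_norm x)) + k * (s * l1_norm (x - z)) - B \<le> ?f"
    by linarith
  then have "(1 - s) * (lam * (s * (l1_norm z - l1_norm x)) + k * (s * l1_norm (x - z)) - B) \<le> (1 - s) * ?f"
    using s by (intro mult_left_mono) auto
  moreover have "lam * l1_norm ?m \<le> lam * (s * l1_norm x + (1 - s) * l1_norm z)"
    using l1 lam by (intro mult_left_mono) auto
  moreover have "penalized F X lam y ?m = ?G ?m + lam * l1_norm ?m"
    "penalized F X lam y x = ?G x + lam * l1_norm x"
    by (simp_all add: penalized_def)
  ultimately have "penalized F X lam y ?m \<le> s * ?G x + (1 - s) * ?G z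
    - (1 - s) * (lam * (s * (l1_norm z - l1_norm x)) + k * (s * l1_norm (x - z)) - B)
    + lam * (s * l1_norm x + (1 - s) * l1_norm z)"
    using G by linarith
  also have "\<dots> = ?G x + lam * l1_norm x - (1 - s) *
     (s * (?G x - ?G z - B + k * l1_norm (x - z)) + (1 - s) * (?G x - ?G z - B + lam * (l1_norm x - l1_norm z)))"
  proof -
    have "s * a + (1 - s) * b - (1 - s) * (lam * (s * (d - c)) + k * (s * e) - B) + lam * (s * c + (1 - s) * d)
      = a + lam * c - (1 - s) * (s * (a - b - B + k * e) + (1 - s) * (a - b - B + lam * (c - d)))"
      for a b c d e :: real
      by (simp add: algebra_simps)
    then show ?thesis .
  qed
  finally show ?thesis by (simp add: penalized_def)
qed

text \<open>
  The zero temperature analogue of the bound on Gibbs means: a minimizer cannot be improved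
  by contracting it towards \<open>z\<close>.
\<close>
lemma dilation_bound_at_minimizer:
  fixes q r :: "'a::real_vector \<Rightarrow> real"
  assumes dil: "\<And>s x. 0 < s \<Longrightarrow> s < 1 \<Longrightarrow>
      V (z + s *\<^sub>R (x - z)) \<le> V x - (1 - s) * (s * q x + (1 - s) * r x)"
    and min: "\<And>x. V x' \<le> (V x :: real)"
  shows "q x' \<le> 0"
proof -
  have le: "s * q x' + (1 - s) * r x' \<le> 0" if s: "0 < s" "s < 1" for s
  proof -
    have "(1 - s) * (s * q x' + (1 - s) * r x') \<le> 0"
      using dil[OF s, of x'] min[of "z + s *\<^sub>R (x' - z)"] by linarith
    then show ?thesis using s by (simp add: mult_le_0_iff)
  qed
  have "((\<lambda>s. s * q x' + (1 - s) * r x') \<longlongrightarrow> 1 * q x' + (1 - 1) * r x') (at_left 1)"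
    by (intro tendsto_intros)
  moreover have "eventually (\<lambda>s::real. 0 < s \<and> s < 1) (at_left 1)"
    using eventually_at_left_real[of 0 1] by simp
  then have "eventually (\<lambda>s. s * q x' + (1 - s) * r x' \<le> 0) (at_left 1)"
    by (rule eventually_mono) (use le in auto)
  ultimately have "1 * q x' + (1 - 1) * r x' \<le> 0"
    by (intro tendsto_upperbound[of _ _ "at_left (1::real)"]) auto
  then show ?thesis by simp
qed

lemma excess_loss_diff_le:
  fixes X :: "real ^ 'p ^ 'n"
  assumes noise: "\<And>w. \<bar>gradient (\<lambda>u. F u y) (X *v x0) \<bullet> (X *v w)\<bar> \<le> real CARD('n) * k * l1_norm w"
  shows "excess_loss F X y x x0 - excess_loss F X y z x0
    \<le> F (X *v x) y / real CARD('n) - F (X *v z) y / real CARD('n) + k * l1_norm (x - z)"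
proof -
  let ?n = "real CARD('n)" and ?g = "gradient (\<lambda>u. F u y) (X *v x0)"
  have "excess_loss F X y x x0 - excess_loss F X y z x0
    = F (X *v x) y / ?n - F (X *v z) y / ?n - (?g \<bullet> (X *v (x - z))) / ?n"
    unfolding excess_loss_def matrix_vector_mult_diff_distrib inner_diff_right
    by (simp add: diff_divide_distrib)
  moreover have "- (?g \<bullet> (X *v (x - z))) / ?n \<le> (?n * k * l1_norm (x - z)) / ?n"
    using noise[of "x - z"] by (intro divide_right_mono) auto
  ultimately show ?thesis by simp
qed

text \<open>
  For \<open>k < lam\<close> the penalty dominates the linear part of the loss at \<open>x0\<close>, which makes the
  penalized loss coercive.
\<close>
lemma penalized_lower_bound:
  fixes X :: "real ^ 'p ^ 'n"
  assumes L: "\<And>u v. F u y + gradient (\<lambda>u. F u y) u \<bullet> (v - u) + \<phi> (norm (v - u)) \<le> F v y"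
    and \<phi>: "\<And>t. 0 \<le> t \<Longrightarrow> 0 \<le> \<phi> t" and k: "0 \<le> k"
    and noise: "\<And>w. \<bar>gradient (\<lambda>u. F u y) (X *v x0) \<bullet> (X *v w)\<bar> \<le> real CARD('n) * k * l1_norm w"
  shows "(F (X *v x0) y / real CARD('n) - k * l1_norm x0) + (lam - k) * l1_norm x \<le> penalized F X lam y x"
proof -
  let ?n = "real CARD('n)" and ?g = "gradient (\<lambda>u. F u y) (X *v x0)"
  have "- (?n * k * l1_norm (x - x0)) \<le> ?g \<bullet> (X *v (x - x0))"
    using noise[of "x - x0"] by linarith
  then have "F (X *v x0) y - ?n * k * l1_norm (x - x0) \<le> F (X *v x) y"
    using L[of "X *v x0" "X *v x"] \<phi>[of "norm (X *v x - X *v x0)"]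
    by (simp add: matrix_vector_mult_diff_distrib)
  then have "(F (X *v x0) y - ?n * k * l1_norm (x - x0)) / ?n \<le> F (X *v x) y / ?n"
    by (rule divide_right_mono) simp
  then have "F (X *v x0) y / ?n - k * l1_norm (x - x0) \<le> F (X *v x) y / ?n"
    by (simp add: diff_divide_distrib)
  moreover have "l1_norm (x - x0) \<le> l1_norm x + l1_norm x0"
    using l1_norm_triangle[of x "- x0"] l1_norm_scaleR[of "-1" x0] by simp
  then have "k * l1_norm (x - x0) \<le> k * (l1_norm x + l1_norm x0)"
    using k by (rule mult_left_mono)
  ultimately show ?thesis by (simp add: penalized_def algebra_simps)
qed

lemma norm_le_l1_norm: "norm x \<le> l1_norm x"
  unfolding norm_vec_def l1_norm_def by (rule order_trans[OF L2_set_le_sum_abs]) simp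

text \<open>
  Jensen's inequality for the convex function \<open>x \<mapsto> R(x, x0)\<close>, written with the unnormalized
  weight and proved with the supporting hyperplane at the mean.
\<close>
lemma excess_loss_ewa_le:
  fixes X :: "real ^ 'p ^ 'n" and F :: "real ^ 'n \<Rightarrow> real ^ 'n \<Rightarrow> real" and y :: "real ^ 'n"
    and lam \<beta> :: real
  defines "w \<equiv> \<lambda>x. exp (- penalized F X lam y x / \<beta>)"
  assumes L: "\<And>u v. F u y + gradient (\<lambda>u. F u y) u \<bullet> (v - u) + \<phi> (norm (v - u)) \<le> F v y"
    and \<phi>: "\<And>t. 0 \<le> t \<Longrightarrow> 0 \<le> \<phi> t"
    and w: "integrable lborel w"
    and Z: "0 < (\<integral>x. w x \<partial>lborel)"
    and wl: "integrable lborel (\<lambda>x. w x * l1_norm x)"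
    and we: "integrable lborel (\<lambda>x. w x * excess_loss F X y x x0)"
  shows "(\<integral>x. w x \<partial>lborel) * excess_loss F X y (ewa F X lam \<beta> y) x0
    \<le> (\<integral>x. w x * excess_loss F X y x x0 \<partial>lborel)"
proof -
  let ?w = "w" and ?R = "\<lambda>x. excess_loss F X y x x0"
  define m where "m = ewa F X lam \<beta> y"
  define Z where "Z = (\<integral>x. ?w x \<partial>lborel)"
  have meas: "?w \<in> borel_measurable borel" using borel_measurable_integrable[OF w] by simp
  have wx: "integrable lborel (\<lambda>x. ?w x *\<^sub>R x)"
  proof (rule Bochner_Integration.integrable_bound[OF wl])
    show "AE x in lborel. norm (?w x *\<^sub>R x) \<le> norm (?w x * l1_norm x)"
      by (intro AE_I2) (simp add: abs_mult l1_norm_nonneg norm_le_l1_norm mult_left_mono)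
  qed (use meas in measurable)
  have "m = (\<integral>x. (1 / Z) *\<^sub>R (?w x *\<^sub>R x) \<partial>lborel)"
    by (simp add: m_def ewa_def ewa_density_def Z_def w_def)
  also have "\<dots> = (1 / Z) *\<^sub>R (\<integral>x. ?w x *\<^sub>R x \<partial>lborel)"
    by (rule integral_scaleR_right)
  finally have m: "(\<integral>x. ?w x *\<^sub>R x \<partial>lborel) = Z *\<^sub>R m"
    using Z by (simp add: Z_def)
  define c where "c = (1 / real CARD('n)) *\<^sub>R
     (transpose X *v (gradient (\<lambda>u. F u y) (X *v m) - gradient (\<lambda>u. F u y) (X *v x0)))"
  have c: "?R m + c \<bullet> (x - m) \<le> ?R x" for x
  proof -
    let ?g = "gradient (\<lambda>u. F u y)" and ?n = "real CARD('n)"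
    have "F (X *v m) y + ?g (X *v m) \<bullet> (X *v x - X *v m) \<le> F (X *v x) y"
      using L[of "X *v m" "X *v x"] \<phi>[of "norm (X *v x - X *v m)"] by simp
    then have "F (X *v m) y - F (X *v x0) y - ?g (X *v x0) \<bullet> (X *v m - X *v x0)
        + (?g (X *v m) - ?g (X *v x0)) \<bullet> (X *v (x - m))
      \<le> F (X *v x) y - F (X *v x0) y - ?g (X *v x0) \<bullet> (X *v x - X *v x0)"
      by (simp add: matrix_vector_mult_diff_distrib inner_diff_left inner_diff_right)
    then have "(1 / ?n) * (F (X *v m) y - F (X *v x0) y - ?g (X *v x0) \<bullet> (X *v m - X *v x0)
        + (?g (X *v m) - ?g (X *v x0)) \<bullet> (X *v (x - m)))
      \<le> ?R x"
      unfolding excess_loss_def by (rule mult_left_mono) simp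
    moreover have "c \<bullet> (x - m) = (1 / ?n) * ((?g (X *v m) - ?g (X *v x0)) \<bullet> (X *v (x - m)))"
      unfolding c_def by (simp add: dot_lmul_matrix)
    ultimately show ?thesis
      unfolding excess_loss_def by (simp add: distrib_left)
  qed
  have lin: "integrable lborel (\<lambda>x. c \<bullet> (?w x *\<^sub>R x))"
    by (intro integrable_inner_right wx)
  have linv: "(\<integral>x. c \<bullet> (?w x *\<^sub>R x) \<partial>lborel) = Z * (c \<bullet> m)"
    using integral_inner_right[of c lborel "\<lambda>x. ?w x *\<^sub>R x"] wx unfolding m by simp
  have "Z * ?R m = (\<integral>x. ?w x * (?R m - c \<bullet> m) + c \<bullet> (?w x *\<^sub>R x) \<partial>lborel)"
    using w lin linv by (simp add: Z_def[symmetric] right_diff_distrib del: inner_scaleR_right)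
  also have "\<dots> \<le> (\<integral>x. ?w x * ?R x \<partial>lborel)"
  proof (rule integral_mono)
    fix x
    have "?w x * (?R m + c \<bullet> (x - m)) \<le> ?w x * ?R x"
      by (rule mult_left_mono[OF c]) (simp add: w_def)
    then show "?w x * (?R m - c \<bullet> m) + c \<bullet> (?w x *\<^sub>R x) \<le> ?w x * ?R x"
      by (simp add: algebra_simps)
  qed (use w lin we in auto)
  finally show ?thesis by (simp add: Z_def m_def)
qed

lemma oracle_boundI:
  assumes "\<And>z. ereal r \<le> ereal (excess_loss F X y z x0) + ereal (1 / real CARD('n)) *
          mono_conj \<phi>
            (ereal (lam * sqrt (real CARD('n)) * (\<tau> + 1) * sqrt (real (card (supp z)))) /
             (ereal \<tau> * Upsilon (X :: real ^ 'p ^ 'n) (span ((\<lambda>i. axis i 1) ` supp z)) ((\<tau> + 1) / (\<tau> - 1))))"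
  shows "ereal r \<le> oracle_bound F X \<phi> lam \<tau> y x0"
  unfolding oracle_bound_def using assms by (auto intro!: INF_greatest)

text \<open>
  The deterministic part. By duality, the hypothesis \<open>noise\<close> says that every coordinate of
  \<open>X\<^sup>T \<nabla>F(X x0, y) / n\<close> is at most \<open>\<lambda> / \<tau>\<close> in absolute value. In the proof, \<open>C z\<close> is the remainder
  term of the oracle bound at the comparison point \<open>z\<close>. Where it is infinite there is nothing to
  show; where it is a real number \<open>B\<close>, this \<open>B\<close> is the constant required for contractions.
\<close>
lemma oracle_inequalities:
  fixes X :: "real ^ 'p ^ 'n" and F :: "real ^ 'n \<Rightarrow> real ^ 'n \<Rightarrow> real"
  assumes L: "\<And>u v. F u y + gradient (\<lambda>u. F u y) u \<bullet> (v - u) + \<phi> (norm (v - u)) \<le> F v y"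
    and cont: "continuous_on UNIV (\<lambda>u. F u y)"
    and \<phi>: "\<And>t. 0 \<le> t \<Longrightarrow> 0 \<le> \<phi> t" and \<phi>0: "\<phi> 0 = 0"
    and lam: "0 < lam" and b: "0 < \<beta>" and tau: "1 < \<tau>"
    and noise: "\<And>w. \<bar>gradient (\<lambda>u. F u y) (X *v x0) \<bullet> (X *v w)\<bar>
        \<le> real CARD('n) * (lam / \<tau>) * l1_norm w"
  shows ewa_oracle_inequality:
      "ereal (excess_loss F X y (ewa F X lam \<beta> y) x0)
        \<le> oracle_bound F X \<phi> lam \<tau> y x0 + ereal (real CARD('p) * \<beta>)"
    and penalized_oracle_inequality:
      "(\<And>x. penalized F X lam y x' \<le> penalized F X lam y x) \<Longrightarrow>
        ereal (excess_loss F X y x' x0) \<le> oracle_bound F X \<phi> lam \<tau> y x0"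
proof -
  let ?n = "real CARD('n)" and ?p = "real CARD('p)" and ?R = "\<lambda>x. excess_loss F X y x x0"
  let ?V = "penalized F X lam y" and ?G = "\<lambda>x. F (X *v x) y / ?n" and ?k = "lam / \<tau>"
  define C where "C z = ereal (1 / ?n) *
          mono_conj \<phi>
            (ereal (lam * sqrt ?n * (\<tau> + 1) * sqrt (real (card (supp z)))) /
             (ereal \<tau> * Upsilon X (span ((\<lambda>i. axis i 1) ` supp z)) ((\<tau> + 1) / (\<tau> - 1))))" for z
  have C0: "0 \<le> C z" for z
    unfolding C_def using mono_conj_nonneg[of \<phi>, OF \<phi>0] by (intro ereal_0_le_mult) auto
  have C: "ereal (lam * (l1_norm z - l1_norm x) + ?k * l1_norm (x - z) - \<phi> (norm (X *v (x - z))) / ?n) \<le> C z" for x z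
  proof -
    have "0 < (\<tau> + 1) / (\<tau> - 1)" using tau by simp
    then show ?thesis
      using order_trans[OF _ compatibility_le_mono_conj[where \<phi>=\<phi>, OF \<phi>0 \<phi> _ lam tau, of "(\<tau> + 1) / (\<tau> - 1)" "supp z" "x - z" X]]
        l1_penalty_decomposition[OF lam tau refl, of z x]
      unfolding C_def by simp
  qed
  define q where "q z B x = ?G x - ?G z - B + ?k * l1_norm (x - z)" for z B x
  define r where "r z B x = ?G x - ?G z - B + lam * (l1_norm x - l1_norm z)" for z B x
  have dil: "?V (z + s *\<^sub>R (x - z)) \<le> ?V x - (1 - s) * (s * q z B x + (1 - s) * r z B x)"
    if "C z = ereal B" "0 < s" "s < 1" for z B s x
    unfolding q_def r_def
    by (rule penalized_dilation[where F=F and y=y and \<phi>=\<phi>, OF L \<phi> lam _ that(2,3)]) (use C[of z] that(1) in auto)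
  have Rq: "?R x - ?R z \<le> q z B x + B" for x z B
    unfolding q_def using excess_loss_diff_le[where F=F and y=y, OF noise, of x z] by linarith
  show "ereal (?R x') \<le> oracle_bound F X \<phi> lam \<tau> y x0" if min: "\<And>x. ?V x' \<le> ?V x" for x'
  proof (rule oracle_boundI, fold C_def)
    fix z
    show "ereal (?R x') \<le> ereal (?R z) + C z"
    proof (cases "C z")
      case (real B)
      have "q z B x' \<le> 0"
        by (rule dilation_bound_at_minimizer[OF dil[OF real] min])
      then show ?thesis using Rq[of x' z B] real by simp
    qed (use C0[of z] in auto)
  qed
  have cG: "continuous_on UNIV ?G"
    by (intro continuous_intros continuous_on_compose2[OF cont]) auto
  then have mG [measurable]: "?G \<in> borel_measurable borel"
    by (rule borel_measurable_continuous_onI)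
  have Veq: "?V x = ?G x + lam * l1_norm x" for x by (simp add: penalized_def)
  have mV: "?V \<in> borel_measurable borel" unfolding Veq[abs_def] by measurable
  have kl: "0 < lam - ?k" "0 \<le> ?k" using lam tau by (auto simp: field_simps)
  note lower = penalized_lower_bound[where F=F and y=y and \<phi>=\<phi> and k="?k" and lam=lam, OF L \<phi> kl(2) noise]
  define w where "w x = exp (- ?V x / \<beta>)" for x
  define Z where "Z = (\<integral>x. w x \<partial>lborel)"
  note I = integrable_gibbs[OF mV lower kl(1) b, folded w_def]
    integrable_gibbs_energy[OF mV lower kl(1) b, folded w_def]
    integrable_gibbs_l1_norm[OF mV lower kl(1) b, folded w_def]
  have mw [measurable]: "w \<in> borel_measurable borel"
    unfolding w_def[abs_def] using mV by measurable
  have Zpos: "0 < Z"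
  proof -
    have "0 \<le> Z" unfolding Z_def by (rule integral_nonneg_AE) (simp add: w_def)
    moreover have "Z \<noteq> 0"
    proof
      assume "Z = 0"
      then have "AE x in lborel. w x = 0"
        using integral_nonneg_eq_0_iff_AE[OF I(1)] by (simp add: Z_def w_def)
      then have "AE x in (lborel :: (real ^ 'p) measure). False" by (simp add: w_def)
      then show False by (simp add: AE_iff_measurable[OF _ refl])
    qed
    ultimately show ?thesis by simp
  qed
  have wG: "integrable lborel (\<lambda>x. w x * ?G x)"
    using Bochner_Integration.integrable_diff[OF I(2) integrable_mult_right[of lam, OF I(3)]]
    by (simp add: Veq algebra_simps)
  have wd: "integrable lborel (\<lambda>x. w x * l1_norm (x - z))" for z
  proof (rule Bochner_Integration.integrable_bound)
    show "integrable lborel (\<lambda>x. w x * l1_norm x + l1_norm z * w x)"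
      using I by simp
    have "l1_norm (x - z) \<le> l1_norm x + l1_norm z" for x
      using l1_norm_triangle[of x "- z"] l1_norm_scaleR[of "-1" z] by simp
    then have "w x * l1_norm (x - z) \<le> w x * (l1_norm x + l1_norm z)" for x
      by (rule mult_left_mono) (simp add: w_def)
    then show "AE x in lborel. norm (w x * l1_norm (x - z)) \<le> norm (w x * l1_norm x + l1_norm z * w x)"
      by (intro AE_I2) (simp add: abs_mult l1_norm_nonneg w_def algebra_simps)
  qed simp
  have wq: "integrable lborel (\<lambda>x. w x * q z B x)" for z B
  proof -
    have "integrable lborel (\<lambda>x. w x * ?G x - (?G z + B) * w x + ?k * (w x * l1_norm (x - z)))"
      using I wG wd by simp
    then show ?thesis by (simp add: q_def algebra_simps)
  qed
  have wr: "integrable lborel (\<lambda>x. w x * r z B x)" for z B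
  proof -
    have "integrable lborel (\<lambda>x. w x * ?G x - (?G z + B + lam * l1_norm z) * w x + lam * (w x * l1_norm x))"
      using I wG by simp
    then show ?thesis by (simp add: r_def algebra_simps)
  qed
  have wR: "integrable lborel (\<lambda>x. w x * ?R x)"
  proof (rule Bochner_Integration.integrable_bound)
    show "integrable lborel (\<lambda>x. w x * q x0 0 x)" by (rule wq)
    have "continuous_on UNIV (\<lambda>x. excess_loss F X y x x0)"
      unfolding excess_loss_def by (intro continuous_intros continuous_on_compose2[OF cont]) auto
    then have [measurable]: "?R \<in> borel_measurable borel"
      by (rule borel_measurable_continuous_onI)
    show "(\<lambda>x. w x * ?R x) \<in> borel_measurable lborel" by simp
    have "0 \<le> ?R x" for x
    proof -
      have "F (X *v x0) y + gradient (\<lambda>u. F u y) (X *v x0) \<bullet> (X *v x - X *v x0) \<le> F (X *v x) y"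
        using L[of "X *v x0" "X *v x"] \<phi>[of "norm (X *v x - X *v x0)"] by simp
      then show ?thesis unfolding excess_loss_def by simp
    qed
    moreover have "?R x0 = 0" by (simp add: excess_loss_def)
    moreover have "?R x \<le> q x0 0 x" for x using Rq[of x x0 0] \<open>?R x0 = 0\<close> by simp
    ultimately have "\<bar>?R x\<bar> \<le> \<bar>q x0 0 x\<bar>" for x by (smt (verit))
    then show "AE x in lborel. norm (w x * ?R x) \<le> norm (w x * q x0 0 x)"
      by (intro AE_I2) (simp add: abs_mult mult_left_mono)
  qed
  have "ereal (?R (ewa F X lam \<beta> y) - ?p * \<beta>) \<le> oracle_bound F X \<phi> lam \<tau> y x0"
  proof (rule oracle_boundI, fold C_def)
    fix z
    show "ereal (?R (ewa F X lam \<beta> y) - ?p * \<beta>) \<le> ereal (?R z) + C z"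
    proof (cases "C z")
      case (real B)
      have "Z * ?R (ewa F X lam \<beta> y) \<le> (\<integral>x. w x * ?R x \<partial>lborel)"
        using excess_loss_ewa_le[where F=F and y=y and \<phi>=\<phi> and X=X and lam=lam and \<beta>=\<beta> and ?x0.0=x0, OF L \<phi>] I Zpos wR
        unfolding Z_def w_def by simp
      also have "\<dots> \<le> (\<integral>x. w x * q z B x + (B + ?R z) * w x \<partial>lborel)"
      proof (rule integral_mono[OF wR])
        show "integrable lborel (\<lambda>x. w x * q z B x + (B + ?R z) * w x)"
          using wq I by simp
        fix x
        have "w x * ?R x \<le> w x * (q z B x + B + ?R z)"
          using Rq[of x z B] by (intro mult_left_mono) (auto simp: w_def)
        then show "w x * ?R x \<le> w x * q z B x + (B + ?R z) * w x" by (simp add: algebra_simps)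
      qed
      also have "\<dots> = (\<integral>x. w x * q z B x \<partial>lborel) + (B + ?R z) * Z"
        using wq I by (simp add: Z_def)
      also have "(\<integral>x. w x * q z B x \<partial>lborel) \<le> ?p * \<beta> * Z"
        using gibbs_dilation_bound[OF b I(1)[unfolded w_def] wq[unfolded w_def] wr[unfolded w_def] dil[OF real]]
        by (simp add: Z_def w_def)
      finally have "Z * (?R (ewa F X lam \<beta> y)) \<le> Z * (?p * \<beta> + B + ?R z)"
        by (simp add: algebra_simps)
      then have "?R (ewa F X lam \<beta> y) \<le> ?p * \<beta> + B + ?R z"
        using Zpos by simp
      then show ?thesis using real by simp
    qed (use C0[of z] in auto)
  qed
  then show "ereal (?R (ewa F X lam \<beta> y)) \<le> oracle_bound F X \<phi> lam \<tau> y x0 + ereal (?p * \<beta>)"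
    by (cases "oracle_bound F X \<phi> lam \<tau> y x0") auto
qed

section \<open>Bernstein's inequality\<close>

lemma exp_minus_linear_le: "exp u - 1 - u \<le> exp \<bar>u\<bar> - 1 - \<bar>u\<bar>" for u :: real
proof (cases "0 \<le> u")
  case False
  define t where "t = - u"
  have "t \<le> sinh t"
  proof -
    have "sinh 0 - 0 \<le> sinh t - t"
      by (rule DERIV_nonneg_imp_nondecreasing[where f="\<lambda>x. sinh x - x"])
        (use False in \<open>auto simp: t_def cosh_real_ge_1 intro!: derivative_eq_intros exI\<close>)
    then show ?thesis by simp
  qed
  then show ?thesis using False by (simp add: t_def sinh_def)
qed simp

text \<open>
  The first two terms of the exponential series are treated exactly, and the moment condition
  bounds the remaining ones by a geometric series.
\<close>
lemma (in prob_space) bernstein_mgf: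
  fixes W :: "'a \<Rightarrow> real"
  assumes W: "integrable M W" and mean: "expectation W = 0"
    and \<theta>: "0 \<le> \<theta>" and \<kappa>: "0 \<le> \<kappa>" and \<theta>\<kappa>: "\<theta> * \<kappa> < 1" and v: "0 \<le> v"
    and mom: "\<And>m. 2 \<le> m \<Longrightarrow> (\<integral>\<^sup>+x. ennreal (\<bar>W x\<bar> ^ m) \<partial>M) \<le> ennreal (fact m * \<kappa> ^ (m - 2) * v / 2)"
  shows "integrable M (\<lambda>x. exp (\<theta> * W x))"
    and "expectation (\<lambda>x. exp (\<theta> * W x)) \<le> exp (\<theta>\<^sup>2 * v / (2 * (1 - \<theta> * \<kappa>)))"
proof -
  have [measurable]: "W \<in> borel_measurable M" using W by auto
  define C where "C = \<theta>\<^sup>2 * v / (2 * (1 - \<theta> * \<kappa>))"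
  have C0: "0 \<le> C" unfolding C_def using \<theta>\<kappa> v by simp
  define h where "h x = exp (\<theta> * W x) - 1 - \<theta> * W x" for x
  have h0: "0 \<le> h x" for x using exp_ge_add_one_self[of "\<theta> * W x"] unfolding h_def by linarith
  have [measurable]: "h \<in> borel_measurable M" unfolding h_def[abs_def] by simp
  define e where "e m x = \<bar>\<theta> * W x\<bar> ^ (m + 2) / fact (m + 2)" for m x
  have e: "(\<lambda>m. e m x) sums (exp \<bar>\<theta> * W x\<bar> - 1 - \<bar>\<theta> * W x\<bar>)" for x
    using sums_split_initial_segment[OF exp_converges[of "\<bar>\<theta> * W x\<bar>"], of 2]
    by (simp add: e_def eval_nat_numeral divide_inverse mult.commute diff_diff_eq)
  have e0: "0 \<le> e m x" for m x by (simp add: e_def)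
  have emom: "(\<integral>\<^sup>+x. ennreal (e m x) \<partial>M) \<le> ennreal (\<theta>\<^sup>2 * v / 2 * (\<theta> * \<kappa>) ^ m)" for m
  proof -
    have "(\<integral>\<^sup>+x. ennreal (e m x) \<partial>M)
        = (\<integral>\<^sup>+x. ennreal (\<theta> ^ (m + 2) / fact (m + 2)) * ennreal (\<bar>W x\<bar> ^ (m + 2)) \<partial>M)"
      using \<theta> by (intro nn_integral_cong) (simp add: e_def abs_mult power_mult_distrib flip: ennreal_mult)
    also have "\<dots> = ennreal (\<theta> ^ (m + 2) / fact (m + 2)) * (\<integral>\<^sup>+x. ennreal (\<bar>W x\<bar> ^ (m + 2)) \<partial>M)"
      by (rule nn_integral_cmult) simp
    also have "\<dots> \<le> ennreal (\<theta> ^ (m + 2) / fact (m + 2)) * ennreal (fact (m + 2) * \<kappa> ^ m * v / 2)"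
      using mom[of "m + 2"] by (intro mult_left_mono) auto
    also have "\<dots> = ennreal (\<theta> ^ (m + 2) / fact (m + 2) * (fact (m + 2) * \<kappa> ^ m * v / 2))"
      using \<theta> \<kappa> v by (intro ennreal_mult[symmetric]) auto
    also have "\<theta> ^ (m + 2) / fact (m + 2) * (fact (m + 2) * \<kappa> ^ m * v / 2) = \<theta>\<^sup>2 * v / 2 * (\<theta> * \<kappa>) ^ m"
      by (simp add: power_add power_mult_distrib power2_eq_square del: fact_Suc)
    finally show ?thesis .
  qed
  have "(\<integral>\<^sup>+x. ennreal (h x) \<partial>M) \<le> (\<integral>\<^sup>+x. (\<Sum>m. ennreal (e m x)) \<partial>M)"
    using exp_minus_linear_le
    by (intro nn_integral_mono) (simp add: suminf_ennreal_eq[OF e0 e] h_def ennreal_leI)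
  also have "\<dots> = (\<Sum>m. \<integral>\<^sup>+x. ennreal (e m x) \<partial>M)"
    by (rule nn_integral_suminf) (simp add: e_def)
  also have "\<dots> \<le> (\<Sum>m. ennreal (\<theta>\<^sup>2 * v / 2 * (\<theta> * \<kappa>) ^ m))"
    by (intro suminf_le emom) auto
  also have "\<dots> = ennreal C"
  proof (rule suminf_ennreal_eq)
    have "(\<lambda>m. \<theta>\<^sup>2 * v / 2 * (\<theta> * \<kappa>) ^ m) sums (\<theta>\<^sup>2 * v / 2 * (1 / (1 - \<theta> * \<kappa>)))"
      using \<theta> \<kappa> \<theta>\<kappa> by (intro sums_mult geometric_sums) simp
    then show "(\<lambda>m. \<theta>\<^sup>2 * v / 2 * (\<theta> * \<kappa>) ^ m) sums C" by (simp add: C_def)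
  qed (use \<theta> \<kappa> v in auto)
  finally have hC: "(\<integral>\<^sup>+x. ennreal (h x) \<partial>M) \<le> ennreal C" .
  have hint: "integrable M h"
    using hC h0 by (intro integrableI_nonneg) (auto intro: le_less_trans)
  have hE: "expectation h \<le> C"
    using hC h0 C0 nn_integral_eq_integral[OF hint] by (simp add: ennreal_le_iff)
  have eq: "exp (\<theta> * W x) = h x + 1 + \<theta> * W x" for x by (simp add: h_def)
  show "integrable M (\<lambda>x. exp (\<theta> * W x))" unfolding eq using hint W by simp
  have "expectation (\<lambda>x. exp (\<theta> * W x)) = expectation h + 1"
    unfolding eq using hint W mean by (simp add: prob_space)
  also have "\<dots> \<le> exp C" using hE exp_ge_add_one_self[of C] by linarith
  finally show "expectation (\<lambda>x. exp (\<theta> * W x)) \<le> exp (\<theta>\<^sup>2 * v / (2 * (1 - \<theta> * \<kappa>)))"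
    by (simp add: C_def)
qed

text \<open>
  Bernstein's inequality in quantile form. The sharp threshold is \<open>sqrt (2 V t) + \<kappa> t\<close>; the factor
  \<open>2\<close> in the second term lets the choice of \<open>\<theta>\<close> with a closed form suffice in the Chernoff bound.
\<close>
lemma (in prob_space) bernstein_tail:
  fixes W :: "'i \<Rightarrow> 'a \<Rightarrow> real"
  assumes fin: "finite I" and ind: "indep_vars (\<lambda>_. borel) W I"
    and W: "\<And>i. i \<in> I \<Longrightarrow> integrable M (W i)" and mean: "\<And>i. i \<in> I \<Longrightarrow> expectation (W i) = 0"
    and \<kappa>: "0 < \<kappa>" and v: "\<And>i. i \<in> I \<Longrightarrow> 0 \<le> v i"
    and mom: "\<And>i m. i \<in> I \<Longrightarrow> 2 \<le> m \<Longrightarrow>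
      (\<integral>\<^sup>+x. ennreal (\<bar>W i x\<bar> ^ m) \<partial>M) \<le> ennreal (fact m * \<kappa> ^ (m - 2) * v i / 2)"
    and V: "(\<Sum>i\<in>I. v i) \<le> V" "0 < V" and t: "0 < t" and a: "sqrt (2 * V * t) + 2 * \<kappa> * t \<le> a"
  shows "prob {x \<in> space M. a \<le> (\<Sum>i\<in>I. W i x)} \<le> exp (- t)"
proof -
  define b where "b = sqrt (2 * V * t) + 2 * \<kappa> * t"
  define \<theta> where "\<theta> = b / (V + \<kappa> * b)"
  \<comment> \<open>This \<open>\<theta>\<close> gives the exponent \<open>- b\<^sup>2 / (2 (V + \<kappa> b))\<close>, which is at most \<open>- t\<close>.\<close>
  have b0: "0 < b" using V \<kappa> t by (simp add: b_def add_nonneg_pos)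
  have den: "0 < V + \<kappa> * b" using V \<kappa> b0 by (simp add: add_pos_pos)
  have \<theta>0: "0 < \<theta>" using b0 den by (simp add: \<theta>_def)
  have \<theta>\<kappa>: "1 - \<theta> * \<kappa> = V / (V + \<kappa> * b)" using den by (simp add: \<theta>_def field_simps)
  then have \<theta>\<kappa>1: "\<theta> * \<kappa> < 1" using V den by (smt (verit) divide_pos_pos)
  have mgf: "integrable M (\<lambda>x. exp (\<theta> * W i x))"
    "expectation (\<lambda>x. exp (\<theta> * W i x)) \<le> exp (\<theta>\<^sup>2 * v i / (2 * (1 - \<theta> * \<kappa>)))" if "i \<in> I" for i
    using bernstein_mgf[of "W i" \<theta> \<kappa> "v i", OF W mean _ _ \<theta>\<kappa>1 v mom] that \<theta>0 \<kappa> by auto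
  have indE: "indep_vars (\<lambda>_. borel) (\<lambda>i x. exp (\<theta> * W i x)) I"
    by (rule indep_vars_compose2[OF ind]) simp
  have exps: "exp (\<theta> * (\<Sum>i\<in>I. W i x)) = (\<Prod>i\<in>I. exp (\<theta> * W i x))" for x
    by (simp add: sum_distrib_left exp_sum[OF fin])
  have int: "integrable M (\<lambda>x. exp (\<theta> * (\<Sum>i\<in>I. W i x)))"
    unfolding exps by (rule indep_vars_integrable[OF fin indE mgf(1)])
  have "expectation (\<lambda>x. exp (\<theta> * (\<Sum>i\<in>I. W i x))) = (\<Prod>i\<in>I. expectation (\<lambda>x. exp (\<theta> * W i x)))"
    unfolding exps by (rule indep_vars_lebesgue_integral[OF fin indE mgf(1)])
  also have "\<dots> \<le> (\<Prod>i\<in>I. exp (\<theta>\<^sup>2 * v i / (2 * (1 - \<theta> * \<kappa>))))"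
    by (intro prod_mono conjI mgf(2) Bochner_Integration.integral_nonneg) auto
  also have "\<dots> = exp (\<theta>\<^sup>2 * (\<Sum>i\<in>I. v i) / (2 * (1 - \<theta> * \<kappa>)))"
    by (simp add: exp_sum[OF fin] sum_distrib_left sum_divide_distrib)
  also have "\<dots> \<le> exp (\<theta>\<^sup>2 * V / (2 * (1 - \<theta> * \<kappa>)))"
    using V \<theta>\<kappa>1 by (simp add: divide_right_mono mult_left_mono)
  finally have E: "expectation (\<lambda>x. exp (\<theta> * (\<Sum>i\<in>I. W i x))) \<le> exp (\<theta>\<^sup>2 * V / (2 * (1 - \<theta> * \<kappa>)))" .
  have "prob {x \<in> space M. a \<le> (\<Sum>i\<in>I. W i x)}
      \<le> exp (- \<theta> * a) * (\<integral>x\<in>space M. exp (\<theta> * (\<Sum>i\<in>I. W i x)) \<partial>M)"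
    using integrable_mult_indicator[OF sets.top int]
    by (intro Chernoff_ineq_ge \<theta>0) (simp_all add: set_integrable_def)
  also have "(\<integral>x\<in>space M. exp (\<theta> * (\<Sum>i\<in>I. W i x)) \<partial>M) = expectation (\<lambda>x. exp (\<theta> * (\<Sum>i\<in>I. W i x)))"
    by (rule set_integral_space[OF int])
  also have "exp (- \<theta> * a) * \<dots> \<le> exp (- \<theta> * b) * exp (\<theta>\<^sup>2 * V / (2 * (1 - \<theta> * \<kappa>)))"
    using E a \<theta>0 by (intro mult_mono) (auto simp: b_def)
  also have "\<dots> = exp (- (b\<^sup>2 / (2 * (V + \<kappa> * b))))"
  proof -
    have "\<theta>\<^sup>2 * V / (2 * (1 - \<theta> * \<kappa>)) = b\<^sup>2 / (2 * (V + \<kappa> * b))"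
      using V den unfolding \<theta>\<kappa> unfolding \<theta>_def by (simp add: power2_eq_square)
    moreover have "\<theta> * b = 2 * (b\<^sup>2 / (2 * (V + \<kappa> * b)))"
      using den unfolding \<theta>_def by (simp add: power2_eq_square del: distrib_left_numeral)
    ultimately show ?thesis by (simp flip: exp_add)
  qed
  also have "\<dots> \<le> exp (- t)"
  proof -
    have r: "sqrt (2 * V * t) * sqrt (2 * V * t) = 2 * V * t" using V t by simp
    have "b * b - 2 * t * \<kappa> * b = b * sqrt (2 * V * t)"
      by (simp add: b_def algebra_simps)
    also have "\<dots> \<ge> sqrt (2 * V * t) * sqrt (2 * V * t)"
      using V t \<kappa> by (intro mult_right_mono) (auto simp: b_def)
    finally have "t * (2 * (V + \<kappa> * b)) \<le> b\<^sup>2"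
      unfolding r by (simp add: power2_eq_square algebra_simps)
    then show ?thesis using den by (simp add: pos_le_divide_eq)
  qed
  finally show ?thesis .
qed

lemma (in prob_space) bernstein_tail_abs:
  fixes W :: "'i \<Rightarrow> 'a \<Rightarrow> real"
  assumes fin: "finite I" and ind: "indep_vars (\<lambda>_. borel) W I"
    and W: "\<And>i. i \<in> I \<Longrightarrow> integrable M (W i)" and mean: "\<And>i. i \<in> I \<Longrightarrow> expectation (W i) = 0"
    and \<kappa>: "0 < \<kappa>" and v: "\<And>i. i \<in> I \<Longrightarrow> 0 \<le> v i"
    and mom: "\<And>i m. i \<in> I \<Longrightarrow> 2 \<le> m \<Longrightarrow>
      (\<integral>\<^sup>+x. ennreal (\<bar>W i x\<bar> ^ m) \<partial>M) \<le> ennreal (fact m * \<kappa> ^ (m - 2) * v i / 2)"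
    and V: "(\<Sum>i\<in>I. v i) \<le> V" "0 < V" and t: "0 < t" and a: "sqrt (2 * V * t) + 2 * \<kappa> * t \<le> a"
  shows "prob {x \<in> space M. a < \<bar>\<Sum>i\<in>I. W i x\<bar>} \<le> 2 * exp (- t)"
proof -
  have meas [measurable]: "random_variable borel (\<lambda>x. \<Sum>i\<in>I. W i x)"
    by (intro borel_measurable_sum borel_measurable_integrable W)
  have ind': "indep_vars (\<lambda>_. borel) (\<lambda>i x. - W i x) I"
    by (rule indep_vars_compose2[OF ind]) simp
  have P: "prob {x \<in> space M. a \<le> (\<Sum>i\<in>I. W i x)} \<le> exp (- t)"
    by (rule bernstein_tail[OF fin ind W mean \<kappa> v mom V t a])
  have N: "prob {x \<in> space M. a \<le> (\<Sum>i\<in>I. - W i x)} \<le> exp (- t)"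
    by (rule bernstein_tail[OF fin ind' _ _ \<kappa> v _ V t a]) (use W mean mom in auto)
  have "prob {x \<in> space M. a < \<bar>\<Sum>i\<in>I. W i x\<bar>}
      \<le> prob ({x \<in> space M. a \<le> (\<Sum>i\<in>I. W i x)} \<union> {x \<in> space M. a \<le> (\<Sum>i\<in>I. - W i x)})"
    by (intro finite_measure_mono) (auto simp: sum_negf)
  also have "\<dots> \<le> prob {x \<in> space M. a \<le> (\<Sum>i\<in>I. W i x)} + prob {x \<in> space M. a \<le> (\<Sum>i\<in>I. - W i x)}"
    by (intro measure_Un_le) (auto simp: sum_negf)
  finally show ?thesis using P N by simp
qed

section \<open>Derivatives of the loss in the first variable\<close>

lemma GDERIV_line:
  assumes "GDERIV L u :> D"
  shows "((\<lambda>t. L (u + t *\<^sub>R v)) has_real_derivative D \<bullet> v) (at 0)"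
proof -
  have "((\<lambda>t. L (u + t *\<^sub>R v)) has_derivative (\<lambda>t. (t *\<^sub>R v) \<bullet> D)) (at 0)"
    by (rule has_derivative_compose[where g=L and f="\<lambda>t. u + t *\<^sub>R v" and x=0, simplified])
      (use assms in \<open>auto simp: gderiv_def intro!: derivative_eq_intros\<close>)
  then show ?thesis
    by (simp add: has_field_derivative_def inner_commute mult_commute_abs)
qed

lemma GDERIV_difference_quotient_LIMSEQ:
  assumes "GDERIV L u :> D"
  shows "(\<lambda>k. (L (u + inverse (real (Suc k)) *\<^sub>R v) - L u) / inverse (real (Suc k))) \<longlonglongrightarrow> D \<bullet> v"
proof -
  have "(\<lambda>h. (L (u + h *\<^sub>R v) - L u) / h) \<midarrow>0\<rightarrow> D \<bullet> v"
    using GDERIV_line[OF assms, of v] by (simp add: DERIV_def)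
  then show ?thesis
    by (rule filterlim_compose)
      (auto intro!: filterlim_atI LIMSEQ_inverse_real_of_nat simp del: of_nat_Suc)
qed

text \<open>
  Differentiation of an expected convex loss at its minimum. By convexity the difference
  quotients lie between the derivative and the quotient of step one, so dominated convergence
  applies.
\<close>
lemma expected_directional_derivative_nonneg:
  fixes L :: "'b::real_inner \<Rightarrow> 'a \<Rightarrow> real" and D :: "'b \<Rightarrow> 'a \<Rightarrow> 'b"
  assumes conv: "\<And>a b x. L a x + D a x \<bullet> (b - a) \<le> L b x"
    and D: "\<And>x. GDERIV (\<lambda>a. L a x) u :> D u x"
    and L: "\<And>t. integrable M (\<lambda>x. L (u + t *\<^sub>R v) x)"
    and Dint: "integrable M (\<lambda>x. D u x \<bullet> v)"
    and min: "\<And>t. (\<integral>x. L u x \<partial>M) \<le> (\<integral>x. L (u + t *\<^sub>R v) x \<partial>M)"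
  shows "0 \<le> (\<integral>x. D u x \<bullet> v \<partial>M)"
proof -
  define Q where "Q k x = (L (u + inverse (real (Suc k)) *\<^sub>R v) x - L u x) / inverse (real (Suc k))" for k x
  have Lu: "integrable M (\<lambda>x. L u x)" using L[of 0] by simp
  have Qint: "integrable M (Q k)" for k unfolding Q_def[abs_def] using L Lu by simp
  have Qlim: "(\<lambda>k. Q k x) \<longlonglongrightarrow> D u x \<bullet> v" for x
    unfolding Q_def using GDERIV_difference_quotient_LIMSEQ[OF D] .
  have Qlow: "D u x \<bullet> v \<le> Q k x" for k x
  proof -
    have "inverse (real (Suc k)) * (D u x \<bullet> v) \<le> L (u + inverse (real (Suc k)) *\<^sub>R v) x - L u x"
      using conv[of u x "u + inverse (real (Suc k)) *\<^sub>R v"] by simp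
    then show ?thesis unfolding Q_def by (simp add: field_simps del: of_nat_Suc)
  qed
  have Qup: "Q k x \<le> Q 0 x" for k x
  proof -
    let ?s = "inverse (real (Suc k))"
    have s: "0 < ?s" "?s \<le> 1" by (auto simp: field_simps)
    have "L (u + ?s *\<^sub>R v) x \<le> ?s * L (u + v) x + (1 - ?s) * L u x"
      using uniformly_convex_interpolation[where L="\<lambda>a. L a x" and D="\<lambda>a. D a x" and \<phi>="\<lambda>_. 0" and u=u and v="u + v" and s="?s"] conv s by simp
    then have "L (u + ?s *\<^sub>R v) x - L u x \<le> Q 0 x * ?s"
      by (simp add: Q_def algebra_simps)
    then show ?thesis
      unfolding Q_def[of k] using s(1) by (simp only: pos_divide_le_eq)
  qed
  have "(\<lambda>k. \<integral>x. Q k x \<partial>M) \<longlonglongrightarrow> (\<integral>x. D u x \<bullet> v \<partial>M)"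
  proof (rule integral_dominated_convergence)
    show "integrable M (\<lambda>x. \<bar>D u x \<bullet> v\<bar> + \<bar>Q 0 x\<bar>)" using Dint Qint by simp
    show "AE x in M. norm (Q k x) \<le> \<bar>D u x \<bullet> v\<bar> + \<bar>Q 0 x\<bar>" for k
    proof (intro AE_I2)
      fix x
      show "norm (Q k x) \<le> \<bar>D u x \<bullet> v\<bar> + \<bar>Q 0 x\<bar>"
        using Qlow[of x k] Qup[of k x] unfolding real_norm_def by linarith
    qed
  qed (use Dint Qint Qlim in auto)
  moreover have "0 \<le> (\<integral>x. Q k x \<partial>M)" for k
    using L Lu min[of "inverse (real (Suc k))"] by (simp add: Q_def)
  ultimately show ?thesis
    by (intro LIMSEQ_le_const) auto
qed

lemma separable_gradient_component:
  fixes F :: "real ^ 'n \<Rightarrow> real ^ 'n \<Rightarrow> real"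
  assumes F: "\<And>u z. F u z = (\<Sum>i\<in>UNIV. f i (u $ i) (z $ i))"
    and C1: "C1_fun (\<lambda>u. F u z)"
  shows "deriv (\<lambda>a. f i a (z $ i)) (u $ i) = gradient (\<lambda>u. F u z) u $ i"
proof -
  let ?g = "gradient (\<lambda>u. F u z) u"
  have eq: "F (u + t *\<^sub>R axis i 1) z = f i (u $ i + t) (z $ i) + (\<Sum>j\<in>UNIV - {i}. f j (u $ j) (z $ j))" for t
  proof -
    have "F (u + t *\<^sub>R axis i 1) z = f i ((u + t *\<^sub>R axis i 1) $ i) (z $ i)
       + (\<Sum>j\<in>UNIV - {i}. f j ((u + t *\<^sub>R axis i 1) $ j) (z $ j))"
      unfolding F by (rule sum.remove) auto
    also have "(\<Sum>j\<in>UNIV - {i}. f j ((u + t *\<^sub>R axis i 1) $ j) (z $ j)) = (\<Sum>j\<in>UNIV - {i}. f j (u $ j) (z $ j))"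
      by (intro sum.cong) (auto simp: axis_def)
    finally show ?thesis by (simp add: axis_def)
  qed
  have "((\<lambda>t. F (u + t *\<^sub>R axis i 1) z) has_real_derivative ?g \<bullet> axis i 1) (at 0)"
    by (rule GDERIV_line) (use C1 in \<open>auto simp: C1_fun_def\<close>)
  then have "((\<lambda>t. f i (u $ i + t) (z $ i) + (\<Sum>j\<in>UNIV - {i}. f j (u $ j) (z $ j)))
      has_real_derivative ?g $ i) (at 0)"
    by (simp add: eq inner_axis)
  from DERIV_diff[OF this DERIV_const[of "\<Sum>j\<in>UNIV - {i}. f j (u $ j) (z $ j)"]]
  have "((\<lambda>t. f i (u $ i + t) (z $ i)) has_real_derivative ?g $ i) (at 0)"
    by simp
  then have "((\<lambda>a. f i a (z $ i)) has_real_derivative ?g $ i) (at (u $ i))"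
    using DERIV_shift[of "\<lambda>a. f i a (z $ i)" "?g $ i" 0 "u $ i"] by (simp add: add.commute)
  then show ?thesis by (rule DERIV_imp_deriv)
qed

text \<open>
  Measurability in the observation alone: the loss is evaluated at constant observation vectors,
  and the derivative is a limit of difference quotients.
\<close>
lemma borel_measurable_separable_deriv:
  fixes F :: "real ^ 'n \<Rightarrow> real ^ 'n \<Rightarrow> real"
  assumes F: "\<And>u z. F u z = (\<Sum>i\<in>UNIV. f i (u $ i) (z $ i))"
    and C1: "\<And>z. C1_fun (\<lambda>u. F u z)" and meas: "\<And>u. F u \<in> borel_measurable borel"
  shows "(\<lambda>t. deriv (\<lambda>a. f i a t) (u $ i)) \<in> borel_measurable borel"
proof -
  let ?c = "\<lambda>t. (\<chi> j. t) :: real ^ 'n"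
  have c: "?c \<in> borel_measurable borel"
    by (intro borel_measurable_continuous_onI continuous_intros)
  have Fc [measurable]: "(\<lambda>t. F u (?c t)) \<in> borel_measurable borel" for u
    using measurable_compose[OF c meas] .
  have eq: "deriv (\<lambda>a. f i a t) (u $ i) = gradient (\<lambda>u. F u (?c t)) u \<bullet> axis i 1" for t
    using separable_gradient_component[where F=F and f=f, OF F C1, of i "?c t" u] by (simp add: inner_axis)
  show ?thesis
  proof (rule borel_measurable_LIMSEQ_real)
    show "(\<lambda>k. (F (u + inverse (real (Suc k)) *\<^sub>R axis i 1) (?c t) - F u (?c t)) / inverse (real (Suc k)))
        \<longlonglongrightarrow> deriv (\<lambda>a. f i a t) (u $ i)" for t
      unfolding eq by (rule GDERIV_difference_quotient_LIMSEQ) (use C1 in \<open>auto simp: C1_fun_def\<close>)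
  qed measurable
qed

section \<open>The noise event and the conclusion\<close>

lemma inner_matrix_vector_le_l1_norm:
  fixes X :: "real ^ 'p ^ 'n"
  assumes "\<And>j. \<bar>\<Sum>i\<in>UNIV. X $ i $ j * h $ i\<bar> \<le> c"
  shows "\<bar>h \<bullet> (X *v w)\<bar> \<le> c * l1_norm w"
proof -
  have "h \<bullet> (X *v w) = (\<Sum>i\<in>UNIV. \<Sum>j\<in>UNIV. w $ j * (X $ i $ j * h $ i))"
    by (simp add: inner_vec_def matrix_vector_mult_def sum_distrib_left mult_ac)
  also have "\<dots> = (\<Sum>j\<in>UNIV. w $ j * (\<Sum>i\<in>UNIV. X $ i $ j * h $ i))"
    by (subst sum.swap) (simp add: sum_distrib_left)
  also have "\<bar>\<dots>\<bar> \<le> (\<Sum>j\<in>UNIV. \<bar>w $ j\<bar> * c)"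
    using assms by (intro order_trans[OF sum_abs] sum_mono) (simp add: abs_mult mult_left_mono)
  finally show ?thesis by (simp add: l1_norm_def sum_distrib_left mult.commute)
qed

text \<open>
  Bernstein's inequality for each column of the design matrix, followed by a union bound. The
  moment conditions pass to \<open>X\<^sub>i\<^sub>j W\<^sub>i\<close> because the entries of \<open>X\<close> are at most \<open>1\<close> in absolute value.
\<close>
lemma (in prob_space) design_noise_bound:
  fixes X :: "real ^ 'p ^ 'n" and W :: "'n \<Rightarrow> 'a \<Rightarrow> real"
  assumes ind: "indep_vars (\<lambda>_. borel) W UNIV"
    and W: "\<And>i. integrable M (W i)" and mean: "\<And>i. expectation (W i) = 0"
    and \<kappa>: "0 < \<kappa>" and \<sigma>: "0 < \<sigma>" and s: "\<And>i. (s i)\<^sup>2 \<le> \<sigma>\<^sup>2"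
    and mom: "\<And>i m. 2 \<le> m \<Longrightarrow>
      (\<integral>\<^sup>+x. ennreal (\<bar>W i x\<bar> ^ m) \<partial>M) \<le> ennreal (fact m * \<kappa> ^ (m - 2) * (s i)\<^sup>2 / 2)"
    and X: "\<And>i j. \<bar>X $ i $ j\<bar> \<le> 1" and t: "0 < t"
    and a: "\<sigma> * sqrt (2 * t / real CARD('n)) * (1 + sqrt 2 * (\<kappa> / \<sigma>) * sqrt (t / real CARD('n))) \<le> a"
  shows "{x \<in> space M. \<forall>j. \<bar>\<Sum>i\<in>UNIV. X $ i $ j * W i x\<bar> \<le> real CARD('n) * a} \<in> sets M" (is "?A \<in> _")
    and "1 - 2 * real CARD('p) * exp (- t)
      \<le> prob {x \<in> space M. \<forall>j. \<bar>\<Sum>i\<in>UNIV. X $ i $ j * W i x\<bar> \<le> real CARD('n) * a}"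
proof -
  let ?n = "real CARD('n)"
  have [measurable]: "random_variable borel (W i)" for i using W by auto
  define B where "B j = {x \<in> space M. ?n * a < \<bar>\<Sum>i\<in>UNIV. X $ i $ j * W i x\<bar>}" for j
  have B [measurable]: "B j \<in> sets M" for j unfolding B_def by measurable
  have A: "?A = space M - (\<Union>j\<in>UNIV. B j)" unfolding B_def not_le[symmetric] by blast
  show "?A \<in> sets M" unfolding A by measurable
  have thr: "sqrt (2 * (?n * \<sigma>\<^sup>2) * t) + 2 * \<kappa> * t \<le> ?n * a"
  proof -
    define r where "r = sqrt (t / ?n)"
    have r: "r * r = t / ?n" "0 \<le> r" using t by (auto simp: r_def)
    have s2: "sqrt (2 * t / ?n) = sqrt 2 * r"
      unfolding r_def by (simp flip: real_sqrt_mult)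
    have "sqrt (2 * (?n * \<sigma>\<^sup>2) * t) = sqrt ((?n * \<sigma> * (sqrt 2 * r))\<^sup>2)"
      using r by (intro arg_cong[where f=sqrt]) (simp add: power2_eq_square field_simps)
    also have "\<dots> = ?n * \<sigma> * (sqrt 2 * r)" using \<sigma> r by simp
    finally have "sqrt (2 * (?n * \<sigma>\<^sup>2) * t) + 2 * \<kappa> * t
      = ?n * \<sigma> * (sqrt 2 * r) + ?n * (sqrt 2 * sqrt 2) * \<kappa> * (r * r)"
      by (simp add: r(1))
    also have "\<dots> = ?n * (\<sigma> * (sqrt 2 * r) * (1 + sqrt 2 * (\<kappa> / \<sigma>) * r))"
      using \<sigma> by (simp add: field_simps)
    also have "\<dots> \<le> ?n * a"
      using a unfolding s2 r_def[symmetric] by (rule mult_left_mono) simp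
    finally show ?thesis .
  qed
  have PB: "prob (B j) \<le> 2 * exp (- t)" for j
    unfolding B_def
  proof (rule bernstein_tail_abs[where \<kappa>=\<kappa> and v="\<lambda>i. (s i)\<^sup>2" and V="?n * \<sigma>\<^sup>2"])
    show "indep_vars (\<lambda>_. borel) (\<lambda>i x. X $ i $ j * W i x) UNIV"
      by (rule indep_vars_compose2[OF ind]) simp
    show "expectation (\<lambda>x. X $ i $ j * W i x) = 0" for i using mean by simp
    show "(\<Sum>i\<in>UNIV. (s i)\<^sup>2) \<le> ?n * \<sigma>\<^sup>2"
      using sum_mono[of UNIV "\<lambda>i. (s i)\<^sup>2" "\<lambda>_. \<sigma>\<^sup>2"] s by simp
    show "(\<integral>\<^sup>+x. ennreal (\<bar>X $ i $ j * W i x\<bar> ^ m) \<partial>M) \<le> ennreal (fact m * \<kappa> ^ (m - 2) * (s i)\<^sup>2 / 2)"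
      if "2 \<le> m" for i m
    proof -
      have "\<bar>X $ i $ j * W i x\<bar> \<le> \<bar>W i x\<bar>" for x
        using X[of i j] mult_right_mono[of "\<bar>X $ i $ j\<bar>" 1 "\<bar>W i x\<bar>"] by (simp add: abs_mult)
      then have "(\<integral>\<^sup>+x. ennreal (\<bar>X $ i $ j * W i x\<bar> ^ m) \<partial>M) \<le> (\<integral>\<^sup>+x. ennreal (\<bar>W i x\<bar> ^ m) \<partial>M)"
        by (intro nn_integral_mono ennreal_leI power_mono) auto
      then show ?thesis using mom[OF that, of i] by (rule order_trans)
    qed
  qed (use W \<kappa> \<sigma> t thr in auto)
  have "prob (\<Union>j\<in>UNIV. B j) \<le> (\<Sum>j\<in>UNIV. prob (B j))"
    by (rule finite_measure_subadditive_finite) auto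
  also have "\<dots> \<le> (\<Sum>j\<in>(UNIV :: 'p set). 2 * exp (- t))"
    by (intro sum_mono PB)
  finally show "1 - 2 * real CARD('p) * exp (- t) \<le> prob ?A"
    unfolding A by (subst prob_compl) auto
qed

lemma C1_fun_continuous: "C1_fun L \<Longrightarrow> continuous_on UNIV L"
  unfolding C1_fun_def gderiv_def
  by (intro continuous_at_imp_continuous_on ballI) (blast intro: has_derivative_continuous)

theorem corollary3p1:
  fixes M :: "'w measure"
    and y :: "'w \<Rightarrow> real ^ 'n"
    and X :: "real ^ 'p ^ 'n"
    and F :: "real ^ 'n \<Rightarrow> real ^ 'n \<Rightarrow> real"
    and f :: "'n \<Rightarrow> real \<Rightarrow> real \<Rightarrow> real"
    and \<phi> g :: "real \<Rightarrow> real"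
    and x0 :: "real ^ 'p"
    and xpen :: "'w \<Rightarrow> real ^ 'p"
    and lam \<beta> \<kappa> \<sigma> \<tau> \<delta> :: real
    and s :: "'n \<Rightarrow> real"
  assumes prob: "prob_space M"
    and lam_pos: "lam > 0"
    and beta_pos: "\<beta> > 0"
    \<comment> \<open>the risk is a well-defined real-valued function on the whole space, minimized at \<open>x0\<close>\<close>
    and F_meas: "\<And>u. F u \<in> borel_measurable borel"
    and risk_finite: "\<And>x. integrable M (\<lambda>\<omega>. F (X *v x) (y \<omega>))"
    and x0_argmin: "is_arg_min (\<lambda>x. \<integral>\<omega>. F (X *v x) (y \<omega>) \<partial>M) (\<lambda>_. True) x0"
    \<comment> \<open>(1)\<close>
    and phi_convex: "convex_on {0..} \<phi>"
    and phi_mono: "mono_on {0..} \<phi>"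
    and phi_nonneg: "\<And>t. t \<ge> 0 \<Longrightarrow> \<phi> t \<ge> 0"
    and phi_zero: "\<And>t. t \<ge> 0 \<Longrightarrow> \<phi> t = 0 \<longleftrightarrow> t = 0"
    and F_C1: "\<And>z. C1_fun (\<lambda>u. F u z)"
    and F_convex: "\<And>u v z. F v z \<ge> F u z + gradient (\<lambda>u. F u z) u \<bullet> (v - u) + \<phi> (norm (v - u))"
    \<comment> \<open>(2)\<close>
    and F_int: "\<And>xbar z.
      (\<integral>\<^sup>+x. ennreal (exp (- F (X *v x) z / (real CARD('n) * \<beta>)) *
         \<bar>gradient (\<lambda>u. F u z) (X *v x) \<bullet> (X *v (xbar - x))\<bar>) \<partial>lborel) < \<infinity>"
    \<comment> \<open>(3)\<close>
    and y_indep: "prob_space.indep_vars M (\<lambda>_. borel) (\<lambda>i \<omega>. y \<omega> $ i) UNIV"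
    and y_ident: "\<And>i j. distr M borel (\<lambda>\<omega>. y \<omega> $ i) = distr M borel (\<lambda>\<omega>. y \<omega> $ j)"
    and F_sum: "\<And>u z. F u z = (\<Sum>i\<in>UNIV. f i (u $ i) (z $ i))"
    and f_int: "\<And>i. integrable M (\<lambda>\<omega>. f i ((X *v x0) $ i) (y \<omega> $ i))"
    and f_deriv_bound: "\<And>i t. \<bar>deriv (\<lambda>u. f i u t) ((X *v x0) $ i)\<bar> \<le> g t"
    and g_int: "\<And>i. integrable M (\<lambda>\<omega>. g (y \<omega> $ i))"
    and kappa_pos: "\<kappa> > 0"
    and s_pos: "\<And>i. s i > 0"
    and moments: "\<And>i m. m \<ge> 2 \<Longrightarrow>
      (\<integral>\<^sup>+\<omega>. ennreal (\<bar>deriv (\<lambda>u. f i u (y \<omega> $ i)) ((X *v x0) $ i)\<bar> ^ m) \<partial>M)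
        \<le> ennreal (fact m * \<kappa> ^ (m - 2) * (s i)\<^sup>2 / 2)"
    and sigma: "\<sigma> = sqrt (MAX i. (s i)\<^sup>2)"
    and X_rank: "rank X = CARD('n)"
    and X_col: "\<And>j. infnorm (column j X) \<le> 1"
    and tau: "\<tau> > 1"
    and delta: "\<delta> > 1"
    and lam_ge: "lam \<ge> \<tau> * \<sigma> * sqrt (2 * \<delta> * ln (2 * real CARD('p)) / real CARD('n)) *
      (1 + sqrt 2 * (\<kappa> / \<sigma>) * sqrt (\<delta> * ln (2 * real CARD('p)) / real CARD('n)))"
    and xpen_min: "\<And>\<omega>. \<omega> \<in> space M \<Longrightarrow>
      is_arg_min (penalized F X lam (y \<omega>)) (\<lambda>_. True) (xpen \<omega>)"
  shows "\<exists>A\<in>sets M.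
    measure M A \<ge> 1 - 2 * (2 * real CARD('p)) powr (1 - \<delta>) \<and>
    (\<forall>\<omega>\<in>A.
      ereal (excess_loss F X (y \<omega>) (ewa F X lam \<beta> (y \<omega>)) x0)
        \<le> oracle_bound F X \<phi> lam \<tau> (y \<omega>) x0 + ereal (real CARD('p) * \<beta>) \<and>
      ereal (excess_loss F X (y \<omega>) (xpen \<omega>) x0)
        \<le> oracle_bound F X \<phi> lam \<tau> (y \<omega>) x0)"
proof -
  interpret prob_space M by (rule prob)
  let ?n = "real CARD('n)" and ?p = "real CARD('p)"
  define u0 where "u0 = X *v x0"
  define h where "h i t = deriv (\<lambda>u. f i u t) (u0 $ i)" for i t
  let ?g = "\<lambda>z. gradient (\<lambda>u. F u z)"
  have hg: "h i (z $ i) = ?g z u0 $ i" for i z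
    unfolding h_def by (rule separable_gradient_component[where F=F, OF F_sum F_C1])
  have h_meas [measurable]: "h i \<in> borel_measurable borel" for i
    unfolding h_def by (rule borel_measurable_separable_deriv[where F=F, OF F_sum F_C1 F_meas])
  have y_meas [measurable]: "random_variable borel (\<lambda>\<omega>. y \<omega> $ i)" for i
    using y_indep by (simp add: indep_vars_def)
  have h_int: "integrable M (\<lambda>\<omega>. h i (y \<omega> $ i))" for i
  proof (rule Bochner_Integration.integrable_bound[OF g_int[of i]])
    have "\<bar>h i t\<bar> \<le> \<bar>g t\<bar>" for t
      using f_deriv_bound[of i t] unfolding h_def u0_def by linarith
    then show "AE \<omega> in M. norm (h i (y \<omega> $ i)) \<le> norm (g (y \<omega> $ i))" by simp
  qed measurable
  have conv: "F a z + ?g z a \<bullet> (b - a) \<le> F b z" for a b z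
    using F_convex[of a z b] phi_nonneg[of "norm (b - a)"] by simp
  \<comment> \<open>Full row rank makes \<open>X\<close> surjective, so \<open>X x0\<close> minimizes the risk over all of \<open>\<real>\<^sup>n\<close>.\<close>
  have nonneg: "0 \<le> (\<integral>\<omega>. ?g (y \<omega>) u0 \<bullet> v \<partial>M)"
    if int: "integrable M (\<lambda>\<omega>. ?g (y \<omega>) u0 \<bullet> v)" for v
  proof (rule expected_directional_derivative_nonneg[where L="\<lambda>u \<omega>. F u (y \<omega>)" and D="\<lambda>u \<omega>. ?g (y \<omega>) u" and u=u0])
    have "surj ((*v) X)" using X_rank by (simp add: full_rank_surjective)
    then obtain w where w: "v = X *v w" by (metis surjD)
    have step: "u0 + t *\<^sub>R v = X *v (x0 + t *\<^sub>R w)" for t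
      by (simp add: u0_def w matrix_vector_right_distrib matrix_vector_mult_scaleR)
    show "integrable M (\<lambda>\<omega>. F (u0 + t *\<^sub>R v) (y \<omega>))" for t
      unfolding step by (rule risk_finite)
    show "(\<integral>\<omega>. F u0 (y \<omega>) \<partial>M) \<le> (\<integral>\<omega>. F (u0 + t *\<^sub>R v) (y \<omega>) \<partial>M)" for t
      unfolding step unfolding u0_def using x0_argmin by (simp add: is_arg_min_linorder)
  qed (use conv int F_C1 in \<open>auto simp: C1_fun_def\<close>)
  \<comment> \<open>Applied to both signs of a coordinate direction, this shows that the noise is centred.\<close>
  have mean: "expectation (\<lambda>\<omega>. h i (y \<omega> $ i)) = 0" for i
  proof (rule antisym)
    have ax: "?g (y \<omega>) u0 \<bullet> axis i 1 = h i (y \<omega> $ i)" "?g (y \<omega>) u0 \<bullet> - axis i 1 = - h i (y \<omega> $ i)" for \<omega>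
      by (simp_all add: hg inner_axis)
    show "0 \<le> expectation (\<lambda>\<omega>. h i (y \<omega> $ i))"
      using nonneg[of "axis i 1"] h_int unfolding ax by simp
    show "expectation (\<lambda>\<omega>. h i (y \<omega> $ i)) \<le> 0"
      using nonneg[of "- axis i 1"] h_int unfolding ax by simp
  qed
  have sig: "(s i)\<^sup>2 \<le> \<sigma>\<^sup>2" for i
  proof -
    have "(s i)\<^sup>2 \<le> (MAX i. (s i)\<^sup>2)" by (rule Max_ge) auto
    moreover from this have "0 \<le> (MAX i. (s i)\<^sup>2)" by (rule order_trans[rotated]) simp
    ultimately show ?thesis by (simp add: sigma)
  qed
  have sigma_pos: "0 < \<sigma>"
  proof -
    have "0 < (s undefined)\<^sup>2" using s_pos[of undefined] by simp
    also have "\<dots> \<le> (MAX i. (s i)\<^sup>2)" by (rule Max_ge) auto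
    finally show ?thesis by (simp add: sigma)
  qed
  \<comment> \<open>The deviation level: \<open>2 p exp (- t)\<close> is the failure probability, and it is at most the allowed one.\<close>
  define t where "t = \<delta> * ln (2 * ?p)"
  have p1: "1 \<le> ?p" by (simp add: Suc_leI)
  then have "0 < ln (2 * ?p)" by (intro ln_gt_zero) linarith
  then have t: "0 < t" using delta by (simp add: t_def)
  have ind: "indep_vars (\<lambda>_. borel) (\<lambda>i \<omega>. h i (y \<omega> $ i)) UNIV"
    by (rule indep_vars_compose2[OF y_indep]) simp
  have Xle: "\<bar>X $ i $ j\<bar> \<le> 1" for i j
    using component_le_infnorm_cart[of "column j X" i] X_col[of j] by (simp add: column_def)
  have thr: "\<sigma> * sqrt (2 * t / ?n) * (1 + sqrt 2 * (\<kappa> / \<sigma>) * sqrt (t / ?n)) \<le> lam / \<tau>"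
    using lam_ge tau by (simp add: t_def pos_le_divide_eq mult_ac)
  define A where "A = {\<omega> \<in> space M. \<forall>j. \<bar>\<Sum>i\<in>UNIV. X $ i $ j * h i (y \<omega> $ i)\<bar> \<le> ?n * (lam / \<tau>)}"
  note noise = design_noise_bound[where W="\<lambda>i \<omega>. h i (y \<omega> $ i)" and X=X and a="lam / \<tau>",
      OF ind h_int mean kappa_pos sigma_pos sig _ Xle t thr, folded A_def]
  have mom: "(\<integral>\<^sup>+\<omega>. ennreal (\<bar>h i (y \<omega> $ i)\<bar> ^ m) \<partial>M) \<le> ennreal (fact m * \<kappa> ^ (m - 2) * (s i)\<^sup>2 / 2)"
    if "2 \<le> m" for i m
    using moments[OF that, of i] by (simp add: h_def u0_def)
  have "2 * ?p * exp (- t) = (2 * ?p) powr (1 - \<delta>)"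
    using p1 by (simp add: powr_def t_def left_diff_distrib exp_diff exp_minus divide_inverse)
  moreover have "0 \<le> (2 * ?p) powr (1 - \<delta>)" by simp
  ultimately have prob: "1 - 2 * (2 * ?p) powr (1 - \<delta>) \<le> measure M A"
    using noise(2)[OF mom] by linarith
  show ?thesis
  proof (intro bexI[of _ A] conjI ballI)
    show "A \<in> sets M" by (rule noise(1)[OF mom])
    show "1 - 2 * (2 * ?p) powr (1 - \<delta>) \<le> measure M A" by (rule prob)
    fix \<omega> assume \<omega>: "\<omega> \<in> A"
    have score: "\<bar>?g (y \<omega>) (X *v x0) \<bullet> (X *v w)\<bar> \<le> ?n * (lam / \<tau>) * l1_norm w" for w
    proof (rule inner_matrix_vector_le_l1_norm)
      show "\<bar>\<Sum>i\<in>UNIV. X $ i $ j * ?g (y \<omega>) (X *v x0) $ i\<bar> \<le> ?n * (lam / \<tau>)" for j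
        using \<omega> unfolding A_def hg u0_def by blast
    qed
    have phi0: "\<phi> 0 = 0" using phi_zero[of 0] by simp
    note bounds = oracle_inequalities[where F=F and y="y \<omega>" and \<phi>=\<phi>, OF F_convex
        C1_fun_continuous[OF F_C1] phi_nonneg phi0 lam_pos beta_pos tau score]
    show "ereal (excess_loss F X (y \<omega>) (ewa F X lam \<beta> (y \<omega>)) x0)
        \<le> oracle_bound F X \<phi> lam \<tau> (y \<omega>) x0 + ereal (real CARD('p) * \<beta>)"
      by (rule bounds(1))
    have pen: "penalized F X lam (y \<omega>) (xpen \<omega>) \<le> penalized F X lam (y \<omega>) x" for x
      using xpen_min[of \<omega>] \<omega> by (auto simp: A_def is_arg_min_linorder)
    show "ereal (excess_loss F X (y \<omega>) (xpen \<omega>) x0) \<le> oracle_bound F X \<phi> lam \<tau> (y \<omega>) x0"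
      by (rule bounds(2)[OF _ pen])
  qed
qed

end
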